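(* Let $g\ge 0$ and $n\ge 1$. The total winding number map $\omega:B_n(\Sigma_g)\to H_1(\Sigma_g;\mathbb{Z})$ is surjective.
   Context: $\Sigma_g$ is the closed orientable surface of genus $g$. $F_n(\Sigma_g)=\{(y_1,\dots,y_n)\in\Sigma_g^n : y_i\ne y_j \text{ for } i\neq j\}$, $C_n(\Sigma_g)=F_n(\Sigma_g)/S_n$ (the symmetric group permuting coordinates), $\pi:F_n(\Sigma_g)\to C_n(\Sigma_g)$ is the quotient covering map, $p_i:F_n(\Sigma_g)\to\Sigma_g$ is the $i$-th coordinate projection, and $B_n(\Sigma_g)=\pi_1(C_n(\Sigma_g),[x_1,\dots,x_n])$ for a fixed basepoint $[x_1,\dots,x_n]$. Total winding number map: for $[\phi]\in B_n(\Sigma_g)$ let $\tilde\phi:[0,1]\to F_n(\Sigma_g)$ be the unique lift of $\phi$ along $\pi$ with $\tilde\phi(0)=(x_1,\dots,x_n)$; then $\omega([\phi])=\left[\sum_{i=1}^n (p_i\circ\tilde\phi)\right]\in H_1(\Sigma_g;\mathbb{Z})$, the class of the singular $1$-cycle that is the sum of the strands viewed as singular $1$-simplices. It is a group homomorphism. *)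

theory Defs
  imports "HOL-Analysis.Analysis" "HOL-Homology.Homology" "HOL-Combinatorics.Permutations"
begin

section \<open>Closed orientable surfaces\<close>

definition closed_surface :: "'a topology \<Rightarrow> bool" where
  "closed_surface X \<longleftrightarrow>
     topspace X \<noteq> {} \<and> compact_space X \<and> connected_space X \<and>
     Hausdorff_space X \<and> second_countable X \<and>
     (\<forall>y\<in>topspace X. \<exists>U (V :: (real^2) set).
        openin X U \<and> y \<in> U \<and> open V \<and> subtopology X U homeomorphic_space top_of_set V)"

text \<open>
  An orientation of a topological surface is a choice of generators of the local homology
  groups \<open>H\<^sub>2(X, X - y)\<close> which locally come from a single class in \<open>H\<^sub>2(X, X - U)\<close>.
\<close>

definition surface_orientation :: "'a topology \<Rightarrow> ('a \<Rightarrow> 'a chain set) \<Rightarrow> bool" where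
  "surface_orientation X \<mu> \<longleftrightarrow>
     (\<forall>y\<in>topspace X.
        \<mu> y \<in> carrier (relative_homology_group 2 X (topspace X - {y})) \<and>
        generate (relative_homology_group 2 X (topspace X - {y})) {\<mu> y}
          = carrier (relative_homology_group 2 X (topspace X - {y}))) \<and>
     (\<forall>y\<in>topspace X. \<exists>U. openin X U \<and> y \<in> U \<and>
        (\<exists>\<alpha>\<in>carrier (relative_homology_group 2 X (topspace X - U)).
           \<forall>z\<in>U. hom_induced 2 X (topspace X - U) X (topspace X - {z}) id \<alpha> = \<mu> z))"

definition orientable_surface :: "'a topology \<Rightarrow> bool" where
  "orientable_surface X \<longleftrightarrow> (\<exists>\<mu>. surface_orientation X \<mu>)"

text \<open>
  The genus is the largest number of pairwise disjoint simple closed curves along which the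
  surface can be cut without being disconnected.
\<close>

definition nonseparating_system :: "'a topology \<Rightarrow> 'a set set \<Rightarrow> bool" where
  "nonseparating_system X \<C> \<longleftrightarrow>
     finite \<C> \<and> pairwise disjnt \<C> \<and>
     (\<forall>C\<in>\<C>. C \<subseteq> topspace X \<and> subtopology X C homeomorphic_space nsphere 1) \<and>
     connected_space (subtopology X (topspace X - \<Union>\<C>))"

definition has_genus :: "'a topology \<Rightarrow> nat \<Rightarrow> bool" where
  "has_genus X g \<longleftrightarrow>
     (\<exists>\<C>. nonseparating_system X \<C> \<and> card \<C> = g) \<and>
     (\<forall>\<C>. nonseparating_system X \<C> \<longrightarrow> card \<C> \<le> g)"

text \<open>By the classification of surfaces this determines \<open>X\<close> up to homeomorphism.\<close>

definition closed_orientable_surface :: "nat \<Rightarrow> 'a topology \<Rightarrow> bool" where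
  "closed_orientable_surface g X \<longleftrightarrow>
     closed_surface X \<and> orientable_surface X \<and> has_genus X g"


section \<open>Quotient topology\<close>

definition quotient_topology :: "'a topology \<Rightarrow> ('a \<Rightarrow> 'b) \<Rightarrow> 'b topology" where
  "quotient_topology X q =
     topology (\<lambda>U. U \<subseteq> q ` topspace X \<and> openin X {y \<in> topspace X. q y \<in> U})"

lemma openin_quotient_topology:
  "openin (quotient_topology X q) U \<longleftrightarrow>
     U \<subseteq> q ` topspace X \<and> openin X {y \<in> topspace X. q y \<in> U}"
proof -
  have "istopology (\<lambda>U. U \<subseteq> q ` topspace X \<and> openin X {y \<in> topspace X. q y \<in> U})"
    unfolding istopology_def
  proof (intro conjI allI impI)
    fix S T
    assume S: "S \<subseteq> q ` topspace X \<and> openin X {y \<in> topspace X. q y \<in> S}"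
      and T: "T \<subseteq> q ` topspace X \<and> openin X {y \<in> topspace X. q y \<in> T}"
    show "S \<inter> T \<subseteq> q ` topspace X" using S by blast
    have "{y \<in> topspace X. q y \<in> S \<inter> T}
        = {y \<in> topspace X. q y \<in> S} \<inter> {y \<in> topspace X. q y \<in> T}" by blast
    then show "openin X {y \<in> topspace X. q y \<in> S \<inter> T}"
      using openin_Int[of X "{y \<in> topspace X. q y \<in> S}" "{y \<in> topspace X. q y \<in> T}"] S T
      by (simp only:)
  next
    fix \<K>
    assume K: "\<forall>K\<in>\<K>. K \<subseteq> q ` topspace X \<and> openin X {y \<in> topspace X. q y \<in> K}"
    show "\<Union>\<K> \<subseteq> q ` topspace X" using K by blast
    have "{y \<in> topspace X. q y \<in> \<Union>\<K>} = (\<Union>K\<in>\<K>. {y \<in> topspace X. q y \<in> K})" by blast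
    moreover have "openin X (\<Union>K\<in>\<K>. {y \<in> topspace X. q y \<in> K})"
      using K by (intro openin_Union) blast
    ultimately show "openin X {y \<in> topspace X. q y \<in> \<Union>\<K>}" by (simp only:)
  qed
  then show ?thesis
    by (simp add: quotient_topology_def topology_inverse')
qed

lemma topspace_quotient_topology [simp]:
  "topspace (quotient_topology X q) = q ` topspace X"
proof
  show "topspace (quotient_topology X q) \<subseteq> q ` topspace X"
    by (meson openin_quotient_topology openin_topspace)
  have "{y \<in> topspace X. q y \<in> q ` topspace X} = topspace X" by blast
  then have "openin (quotient_topology X q) (q ` topspace X)"
    by (simp add: openin_quotient_topology)
  then show "q ` topspace X \<subseteq> topspace (quotient_topology X q)"
    by (rule openin_subset)
qed


section \<open>Fundamental group\<close>

text \<open>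
  Paths are functions on all of \<open>\<real>\<close> of which only the restriction to \<open>[0,1]\<close> is relevant;
  the homotopy classes below ignore the values outside \<open>[0,1]\<close>.
\<close>

definition loop_at :: "'a topology \<Rightarrow> 'a \<Rightarrow> (real \<Rightarrow> 'a) \<Rightarrow> bool" where
  "loop_at X b p \<longleftrightarrow> pathin X p \<and> p 0 = b \<and> p 1 = b"

definition loop_homotopic ::
  "'a topology \<Rightarrow> 'a \<Rightarrow> (real \<Rightarrow> 'a) \<Rightarrow> (real \<Rightarrow> 'a) \<Rightarrow> bool" where
  "loop_homotopic X b p q \<longleftrightarrow>
     homotopic_with (\<lambda>r. r 0 = b \<and> r 1 = b) (top_of_set {0..1}) X p q"

definition loop_class :: "'a topology \<Rightarrow> 'a \<Rightarrow> (real \<Rightarrow> 'a) \<Rightarrow> (real \<Rightarrow> 'a) set" where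
  "loop_class X b p = {q. loop_homotopic X b p q}"

text \<open>The library's \<^const>\<open>joinpaths\<close>, but without its type class constraint.\<close>

definition loop_join :: "(real \<Rightarrow> 'a) \<Rightarrow> (real \<Rightarrow> 'a) \<Rightarrow> real \<Rightarrow> 'a" where
  "loop_join p q = (\<lambda>t. if t \<le> 1/2 then p (2 * t) else q (2 * t - 1))"

definition fundamental_group :: "'a topology \<Rightarrow> 'a \<Rightarrow> (real \<Rightarrow> 'a) set monoid" where
  "fundamental_group X b =
     \<lparr>carrier = loop_class X b ` Collect (loop_at X b),
      monoid.mult = (\<lambda>c d. \<Union>p\<in>c. \<Union>q\<in>d. loop_class X b (loop_join p q)),
      one = loop_class X b (\<lambda>t. b)\<rparr>"


section \<open>Configuration spaces and surface braid groups\<close>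

definition ordered_config :: "nat \<Rightarrow> 'a topology \<Rightarrow> (nat \<Rightarrow> 'a) topology" where
  "ordered_config n X =
     subtopology (product_topology (\<lambda>i. X) {1..n}) {y. inj_on y {1..n}}"

definition config_orbit :: "nat \<Rightarrow> (nat \<Rightarrow> 'a) \<Rightarrow> (nat \<Rightarrow> 'a) set" where
  "config_orbit n y = {y \<circ> \<sigma> | \<sigma>. \<sigma> permutes {1..n}}"

definition unordered_config :: "nat \<Rightarrow> 'a topology \<Rightarrow> (nat \<Rightarrow> 'a) set topology" where
  "unordered_config n X = quotient_topology (ordered_config n X) (config_orbit n)"

definition braid_group ::
  "nat \<Rightarrow> 'a topology \<Rightarrow> (nat \<Rightarrow> 'a) \<Rightarrow> (real \<Rightarrow> (nat \<Rightarrow> 'a) set) set monoid" where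
  "braid_group n X x = fundamental_group (unordered_config n X) (config_orbit n x)"


section \<open>Total winding number\<close>

text \<open>Lifts are normalised to be \<^const>\<open>undefined\<close> outside \<open>[0,1]\<close> to make them unique.\<close>

definition config_lift ::
  "nat \<Rightarrow> 'a topology \<Rightarrow> (nat \<Rightarrow> 'a) \<Rightarrow> (real \<Rightarrow> (nat \<Rightarrow> 'a) set) \<Rightarrow> real \<Rightarrow> nat \<Rightarrow> 'a" where
  "config_lift n X x \<phi> =
     (THE \<psi>. \<psi> \<in> extensional {0..1} \<and> pathin (ordered_config n X) \<psi> \<and>
            (\<forall>t\<in>{0..1}. config_orbit n (\<psi> t) = \<phi> t) \<and> \<psi> 0 = x)"

text \<open>
  The standard 1-simplex consists of the \<open>v\<close> with \<open>v 0 + v 1 = 1\<close> and is parametrised by \<open>v 1\<close>,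
  so the path runs from the 0th to the 1st vertex.
\<close>

definition path_simplex :: "(real \<Rightarrow> 'a) \<Rightarrow> (nat \<Rightarrow> real) \<Rightarrow> 'a" where
  "path_simplex p = restrict (\<lambda>v. p (v 1)) (standard_simplex 1)"

definition loop_winding ::
  "nat \<Rightarrow> 'a topology \<Rightarrow> (nat \<Rightarrow> 'a) \<Rightarrow> (real \<Rightarrow> (nat \<Rightarrow> 'a) set) \<Rightarrow> 'a chain set" where
  "loop_winding n X x \<phi> =
     homologous_rel_set 1 X {}
       (\<Sum>i\<in>{1..n}. frag_of (path_simplex (\<lambda>t. config_lift n X x \<phi> t i)))"

text \<open>
  The value on a class is the common value of \<^const>\<open>loop_winding\<close> on its representatives;
  that it does not depend on the representative is homotopy lifting along the covering
  \<^term>\<open>config_orbit n\<close>.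
\<close>

definition total_winding ::
  "nat \<Rightarrow> 'a topology \<Rightarrow> (nat \<Rightarrow> 'a) \<Rightarrow> (real \<Rightarrow> (nat \<Rightarrow> 'a) set) set \<Rightarrow> 'a chain set" where
  "total_winding n X x c = the_elem (loop_winding n X x ` c)"

end

theory Submission
  imports Defs
begin

text \<open>
  Every class in \<open>H\<^sub>1(X)\<close> is represented by a loop based at \<open>x\<^sub>1\<close>, and such a loop can be chosen to avoid
  \<open>x\<^sub>2, \<dots>, x\<^sub>n\<close>: a point \<open>q\<close> of a surface has a disc neighbourhood that stays connected when \<open>q\<close> is
  removed, so \<open>H\<^sub>1(X - q) \<rightarrow> H\<^sub>1(X)\<close> is surjective. Moving the first point along the loop and keeping the
  other points fixed is a braid whose winding number is the given class, because constant paths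
  are null-homologous. That the winding number depends only on the homotopy class of a braid is
  homotopy lifting along \<open>F\<^sub>n(X) \<rightarrow> C\<^sub>n(X)\<close>: a lifted homotopy moves each strand through a square with
  two constant sides.
\<close>

section \<open>Paths as singular chains\<close>

text \<open>Deleting a point destroys compactness, so the points to be avoided are removed within a
  larger class of spaces, the locally planar connected T1 spaces, which is stable under such
  deletions. Connectedness is carried along because a cycle may have several pieces, all of which
  must be joined to \<open>x 1\<close> inside the complement to form one loop. The relative homology
  argument is carried out on chains: the boundary of a chain near q is coned off inside the
  punctured disc, and what is left closes up to a loop in a contractible set.
  \<open>total_winding\<close> is \<open>the_elem\<close> of a set of values, so it can be evaluated
  only once this set is known to be a singleton. The lifting theorem is proved for squares; a path
  is the case of a square that is constant in one direction. Equality in the theorem also asks that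
  every value be a homology class although single strands need not close up: their endpoints are
  permuted, so the boundaries cancel in the sum.\<close>

lemma continuous_map_simplex_coordinate:
  "continuous_map (subtopology (powertop_real UNIV) S) euclideanreal (\<lambda>v. v k)"
  by (intro continuous_map_from_subtopology) (auto intro: continuous_map_product_projection)

lemma standard_simplex_1_eq:
  assumes "v \<in> standard_simplex 1"
  shows "v = (\<lambda>i. if i = 0 then 1 - v 1 else if i = 1 then v 1 else 0)" and "v 1 \<in> {0..1}"
proof -
  have *: "v 0 + v 1 = 1" "\<forall>i>1. v i = 0"
    using assms by (auto simp: standard_simplex_def)
  show "v = (\<lambda>i. if i = 0 then 1 - v 1 else if i = 1 then v 1 else 0)"
  proof
    fix i show "v i = (if i = 0 then 1 - v 1 else if i = 1 then v 1 else 0)"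
      using * by (cases "i \<le> 1") (auto simp: le_Suc_eq)
  qed
  show "v 1 \<in> {0..1}" using assms by (auto simp: standard_simplex_def)
qed

lemma edge_point_in_standard_simplex:
  assumes "t \<in> {0..1}"
  shows "(\<lambda>i. if i = 0 then 1 - t else if i = 1 then t else 0) \<in> standard_simplex 1"
  using assms by (auto simp: standard_simplex_def)

abbreviation path_chain :: "(real \<Rightarrow> 'a) \<Rightarrow> 'a chain" where
  "path_chain p \<equiv> frag_of (path_simplex p)"

abbreviation vertex_simplex :: "'a \<Rightarrow> (nat \<Rightarrow> real) \<Rightarrow> 'a" where
  "vertex_simplex y \<equiv> restrict (\<lambda>_. y) (standard_simplex 0)"

lemma path_simplex_cong:
  assumes "\<And>t. t \<in> {0..1} \<Longrightarrow> p t = q t"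
  shows "path_simplex p = path_simplex q"
  unfolding path_simplex_def using assms standard_simplex_1_eq(2)
  by (intro restrict_ext) blast

lemma singular_simplex_path_simplex:
  assumes "pathin X p"
  shows "singular_simplex 1 X (path_simplex p)"
proof -
  have "continuous_map (subtopology (powertop_real UNIV) (standard_simplex 1)) (top_of_set {0..1}) (\<lambda>v. v 1)"
    using standard_simplex_1_eq(2)
    by (auto simp: continuous_map_in_subtopology continuous_map_simplex_coordinate)
  from continuous_map_compose[OF this assms[unfolded pathin_def]]
  show ?thesis
    by (auto simp: singular_simplex_def path_simplex_def o_def)
qed

text \<open>A simplex is a function of barycentric coordinates; composing it with
  \<open>t \<mapsto> (1 - t, t)\<close> recovers a path. The generators of a 1-chain can thus be
  handled as paths.\<close>

lemma singular_simplex_1_path: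
  assumes "singular_simplex 1 X f"
  obtains p where "pathin X p" "f = path_simplex p"
proof
  let ?e = "\<lambda>t::real. \<lambda>i::nat. if i = 0 then 1 - t else if i = 1 then t else 0"
  let ?p = "f \<circ> ?e"
  have "continuous_map (top_of_set {0..1}) (subtopology (powertop_real UNIV) (standard_simplex 1)) ?e"
  proof (rule continuous_map_into_subtopology)
    show "continuous_map (top_of_set {0..1}) (powertop_real UNIV) ?e"
      unfolding continuous_map_componentwise_UNIV
    proof
      fix k :: nat
      show "continuous_map (top_of_set {0..1}) euclideanreal (\<lambda>t. ?e t k)"
        by (cases "k = 0"; cases "k = 1") (auto intro!: continuous_intros)
    qed
    show "?e \<in> topspace (top_of_set {0..1}) \<rightarrow> standard_simplex 1"
      using edge_point_in_standard_simplex by (auto simp: Pi_iff)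
  qed
  then show "pathin X ?p"
    unfolding pathin_def using assms by (auto simp: singular_simplex_def intro: continuous_map_compose)
  have "f v = f (?e (v 1))" if "v \<in> standard_simplex 1" for v
    using standard_simplex_1_eq(1)[OF that] by (rule arg_cong)
  then show "f = path_simplex ?p"
    using assms unfolding path_simplex_def singular_simplex_def
    by (intro extensionalityI[of _ "standard_simplex 1"]) (simp_all del: One_nat_def)
qed

lemma chain_boundary_path_chain:
  "chain_boundary 1 (path_chain p) = frag_of (vertex_simplex (p 1)) - frag_of (vertex_simplex (p 0))"
proof -
  \<comment> \<open>Face 0 omits the initial vertex, so it is the end of the path; this fixes the
    sign of the boundary.\<close>
  have "singular_face 1 0 (path_simplex p) = vertex_simplex (p 1)"
       "singular_face 1 1 (path_simplex p) = vertex_simplex (p 0)"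
    unfolding singular_face_def path_simplex_def
    using simplical_face_in_standard_simplex[of 1 0] simplical_face_in_standard_simplex[of 1 1]
    by (auto intro!: restrict_ext simp: simplical_face_def standard_simplex_0)
  then show ?thesis
    by (simp add: chain_boundary_of)
qed

text \<open>The boundary of a singular 2-simplex, in the coordinates \<open>(v 1, v 2)\<close>:
  faces 2 and 0 give the two summands, and face 1 carries the minus sign. Relations between paths
  are obtained below by choosing \<open>G\<close>.\<close>

lemma homologous_triangle:
  assumes G: "continuous_map (top_of_set {(a,b). 0 \<le> a \<and> 0 \<le> b \<and> a + b \<le> (1::real)}) X G"
  shows "homologous_rel 1 X {}
    (path_chain (\<lambda>t. G (t, 0)) + path_chain (\<lambda>t. G (1 - t, t))) (path_chain (\<lambda>t. G (0, t)))"
proof -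
  let ?T = "{(a,b). 0 \<le> a \<and> 0 \<le> b \<and> a + b \<le> (1::real)}"
  let ?f = "restrict (\<lambda>v. G (v 1, v 2)) (standard_simplex 2)"
  have *: "v \<in> standard_simplex 2 \<Longrightarrow> 0 \<le> v 1 \<and> 0 \<le> v 2 \<and> v 1 + v 2 \<le> 1" for v
  proof -
    assume "v \<in> standard_simplex 2"
    then have "v 0 + v 1 + v 2 = 1" "0 \<le> v 0" "0 \<le> v 1" "0 \<le> v 2"
      by (auto simp: standard_simplex_def numeral_2_eq_2)
    then show ?thesis by linarith
  qed
  have "continuous_map (subtopology (powertop_real UNIV) (standard_simplex 2)) (top_of_set ?T) (\<lambda>v. (v 1, v 2))"
    using * by (auto simp: continuous_map_in_subtopology continuous_map_pairedI continuous_map_simplex_coordinate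
         simp flip: prod_topology_euclidean)
  from continuous_map_compose[OF this G]
  have s: "singular_simplex 2 X ?f"
    by (auto simp: singular_simplex_def o_def)
  have v01: "v 0 = 1 - v 1" "v 2 = 0" if "v \<in> standard_simplex 1" for v :: "nat \<Rightarrow> real"
    using that by (auto simp: standard_simplex_def)
  have face: "simplical_face k v \<in> standard_simplex 2"
    if "k \<le> 2" "v \<in> standard_simplex 1" for k and v :: "nat \<Rightarrow> real"
    using simplical_face_in_standard_simplex[of 2 k v] that by simp
  have face_coords: "simplical_face 0 v 1 = v 0" "simplical_face 0 v 2 = v 1"
      "simplical_face 1 v 1 = 0" "simplical_face 1 v 2 = v 1"
      "simplical_face 2 v 1 = v 1" "simplical_face 2 v 2 = 0" for v :: "nat \<Rightarrow> real"
    by (simp_all add: simplical_face_def)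
  have "singular_face 2 0 ?f = path_simplex (\<lambda>t. G (1 - t, t))"
       "singular_face 2 1 ?f = path_simplex (\<lambda>t. G (0, t))"
       "singular_face 2 2 ?f = path_simplex (\<lambda>t. G (t, 0))"
    unfolding singular_face_def path_simplex_def
    by (auto intro!: restrict_ext simp: face face_coords v01 simp del: One_nat_def simp flip: One_nat_def)
  then have "chain_boundary 2 (frag_of ?f) =
      path_chain (\<lambda>t. G (t, 0)) + path_chain (\<lambda>t. G (1 - t, t)) - path_chain (\<lambda>t. G (0, t))"
    by (simp add: chain_boundary_of numeral_2_eq_2)
  with s show ?thesis
    unfolding homologous_rel_def singular_boundary
    by (metis Suc_1 singular_chain_of)
qed

section \<open>Constant paths, concatenation, reversal and squares in homology\<close>

lemma continuous_map_pathin_compose: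
  assumes "pathin X p" and "continuous_on S f" "f \<in> S \<rightarrow> {0..1}"
  shows "continuous_map (top_of_set S) X (\<lambda>x. p (f x))"
proof -
  have "continuous_map (top_of_set S) (top_of_set {0..1}) f"
    using assms by (auto simp: continuous_map_in_subtopology)
  from continuous_map_compose[OF this assms(1)[unfolded pathin_def]]
  show ?thesis by (simp add: o_def)
qed

text \<open>All three edges of a constant triangle are the same path, and one copy cancels.\<close>

lemma homologous_const_path:
  assumes "a \<in> topspace X"
  shows "homologous_rel 1 X {} (path_chain (\<lambda>t. a)) 0"
proof -
  have "homologous_rel 1 X {} (path_chain (\<lambda>t. a) + path_chain (\<lambda>t. a)) (path_chain (\<lambda>t. a))"
    using homologous_triangle[where G = "\<lambda>_. a"] assms by simp
  then show ?thesis by (simp add: homologous_rel_def)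
qed

lemma pathin_loop_join:
  assumes "pathin X p" "pathin X q" "p 1 = q 0"
  shows "pathin X (loop_join p q)"
  unfolding pathin_def loop_join_def
proof (rule continuous_map_cases_le)
  show "continuous_map (subtopology (top_of_set {0..1}) {x \<in> topspace (top_of_set {0..1}). x \<le> 1/2}) X (\<lambda>t. p (2 * t))"
    unfolding subtopology_subtopology
    by (rule continuous_map_pathin_compose[OF assms(1)]) (auto intro!: continuous_intros)
  show "continuous_map (subtopology (top_of_set {0..1}) {x \<in> topspace (top_of_set {0..1}). 1/2 \<le> x}) X (\<lambda>t. q (2 * t - 1))"
    unfolding subtopology_subtopology
    by (rule continuous_map_pathin_compose[OF assms(2)]) (auto intro!: continuous_intros)
  show "p (2 * t) = q (2 * t - 1)" if "t = 1/2" for t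
    unfolding that using assms(3) by simp
qed (auto intro!: continuous_intros)

lemma homologous_loop_join:
  assumes "pathin X p" "pathin X q" "p 1 = q 0"
  shows "homologous_rel 1 X {} (path_chain (loop_join p q)) (path_chain p + path_chain q)"
proof -
  let ?r = "loop_join p q"
  let ?G = "\<lambda>(a,b). ?r (a / 2 + b)" \<comment> \<open>sends the vertices of the triangle to \<open>?r\<close> at \<open>0\<close>, \<open>1/2\<close>, \<open>1\<close>\<close>
  have "continuous_map (top_of_set {(a,b). 0 \<le> a \<and> 0 \<le> b \<and> a + b \<le> (1::real)}) X ?G"
    unfolding case_prod_unfold
    by (rule continuous_map_pathin_compose[OF pathin_loop_join[OF assms]]) (auto intro!: continuous_intros)
  from homologous_triangle[OF this]
  have "homologous_rel 1 X {} (path_chain (\<lambda>t. ?G (t, 0)) + path_chain (\<lambda>t. ?G (1 - t, t))) (path_chain (\<lambda>t. ?G (0, t)))" .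
  moreover have "path_simplex (\<lambda>t. ?G (t, 0)) = path_simplex p"
    by (rule path_simplex_cong) (auto simp: loop_join_def)
  moreover have "path_simplex (\<lambda>t. ?G (1 - t, t)) = path_simplex q"
    \<comment> \<open>At \<open>t = 0\<close> the argument is \<open>1/2\<close>, where
      \<open>loop_join\<close> still takes its first branch; the value \<open>p 1\<close> has to be
      traded for \<open>q 0\<close>.\<close>
    by (rule path_simplex_cong) (use assms in \<open>auto simp: loop_join_def field_simps\<close>)
  ultimately show ?thesis
    by (simp add: homologous_rel_sym)
qed

lemma pathin_reverse:
  assumes "pathin X p"
  shows "pathin X (\<lambda>t. p (1 - t))"
  unfolding pathin_def by (rule continuous_map_pathin_compose[OF assms]) (auto intro!: continuous_intros)

text \<open>A triangle depending only on its first coordinate has the edges \<open>p\<close>,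
  \<open>p\<close> reversed and a constant path.\<close>

lemma homologous_reverse:
  assumes "pathin X p"
  shows "homologous_rel 1 X {} (path_chain (\<lambda>t. p (1 - t))) (- path_chain p)"
proof -
  let ?G = "\<lambda>(a,b::real). p a"
  have "continuous_map (top_of_set {(a,b). 0 \<le> a \<and> 0 \<le> b \<and> a + b \<le> (1::real)}) X ?G"
    unfolding case_prod_unfold
    by (rule continuous_map_pathin_compose[OF assms]) (auto intro!: continuous_intros)
  from homologous_triangle[OF this]
  have "homologous_rel 1 X {} (path_chain p + path_chain (\<lambda>t. p (1 - t))) (path_chain (\<lambda>t. p 0))" by simp
  moreover have "homologous_rel 1 X {} (path_chain (\<lambda>t. p 0)) 0"
    using assms by (intro homologous_const_path path_start_in_topspace)
  ultimately have "homologous_rel 1 X {} (path_chain p + path_chain (\<lambda>t. p (1 - t))) 0"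
    using homologous_rel_trans by blast
  then show ?thesis by (simp add: homologous_rel_def algebra_simps)
qed

text \<open>The diagonal cuts the square into two triangles, and both sides of the relation are
  homologous to the path along it.\<close>

lemma homologous_square:
  assumes h: "continuous_map (top_of_set ({0..1::real} \<times> {0..1::real})) X h"
  shows "homologous_rel 1 X {}
    (path_chain (\<lambda>t. h (t, 0)) + path_chain (\<lambda>t. h (1, t)))
    (path_chain (\<lambda>t. h (0, t)) + path_chain (\<lambda>t. h (t, 1)))"
proof -
  let ?T = "{(a,b). 0 \<le> a \<and> 0 \<le> b \<and> a + b \<le> (1::real)}"
  have c: "continuous_map (top_of_set ?T) X (\<lambda>x. h (f x))"
    if "continuous_on ?T f" "f \<in> ?T \<rightarrow> {0..1} \<times> {0..1}" for f
  proof -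
    have "continuous_map (top_of_set ?T) (top_of_set ({0..1} \<times> {0..1})) f"
      using that by (auto simp: continuous_map_in_subtopology)
    from continuous_map_compose[OF this h] show ?thesis by (simp add: o_def)
  qed
  have "continuous_map (top_of_set ?T) X (\<lambda>x. h (fst x + snd x, snd x))"
       "continuous_map (top_of_set ?T) X (\<lambda>x. h (snd x, fst x + snd x))"
    by (rule c; auto intro!: continuous_intros)+
  from this[THEN homologous_triangle]
  have "homologous_rel 1 X {} (path_chain (\<lambda>t. h (t, 0)) + path_chain (\<lambda>t. h (1, t))) (path_chain (\<lambda>t. h (t, t)))"
       "homologous_rel 1 X {} (path_chain (\<lambda>t. h (0, t)) + path_chain (\<lambda>t. h (t, 1))) (path_chain (\<lambda>t. h (t, t)))"
    by simp_all
  then show ?thesis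
    using homologous_rel_trans homologous_rel_sym by blast
qed

section \<open>Cycles as loops\<close>

lemma homologous_rel_trans':
  "homologous_rel p X S a b \<Longrightarrow> homologous_rel p X S b c \<Longrightarrow> homologous_rel p X S a c"
  using homologous_rel_trans by blast

lemma homologous_rel_symD: "homologous_rel p X S a b \<Longrightarrow> homologous_rel p X S b a"
  by (simp add: homologous_rel_sym)

abbreviation vertex0 :: "nat \<Rightarrow> real" where
  "vertex0 \<equiv> \<lambda>j. if j = 0 then 1 else 0"

text \<open>The degree 0 part of the chain homotopy that contracts a space along the paths
  \<open>\<gamma>\<close>. A 0-simplex is read as a point by evaluating it at
  \<open>vertex0\<close>, the only point of the standard 0-simplex.\<close>

definition cone_chain :: "('a \<Rightarrow> real \<Rightarrow> 'a) \<Rightarrow> 'a chain \<Rightarrow> 'a chain" where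
  "cone_chain \<gamma> = frag_extend (\<lambda>f. path_chain (\<gamma> (f vertex0)))"

lemma cone_chain_vertex [simp]: "cone_chain \<gamma> (frag_of (vertex_simplex y)) = path_chain (\<gamma> y)"
  by (simp add: cone_chain_def)

lemma cone_chain_diff: "cone_chain \<gamma> (a - b) = cone_chain \<gamma> a - cone_chain \<gamma> b"
  by (simp add: cone_chain_def frag_extend_diff)

lemma cone_chain_0 [simp]: "cone_chain \<gamma> 0 = 0"
  by (simp add: cone_chain_def)

lemma singular_chain_cone_chain:
  assumes "singular_chain 0 X c" "\<And>y. y \<in> topspace X \<Longrightarrow> pathin X (\<gamma> y)"
  shows "singular_chain 1 X (cone_chain \<gamma> c)"
  unfolding cone_chain_def
proof (rule singular_chain_extend)
  fix f assume "f \<in> Poly_Mapping.keys c"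
  then have "singular_simplex 0 X f"
    using assms(1) by (auto simp: singular_chain_def)
  then have "f vertex0 \<in> topspace X"
    unfolding singular_simplex_def continuous_map_def by (auto simp: Pi_iff)
  then show "singular_chain 1 X (path_chain (\<gamma> (f vertex0)))"
    unfolding singular_chain_of by (intro singular_simplex_path_simplex assms(2))
qed

lemma loop_at_reverse: "loop_at X b p \<Longrightarrow> loop_at X b (\<lambda>t. p (1 - t))"
  by (simp add: loop_at_def pathin_reverse)

lemma loop_at_join: "loop_at X b p \<Longrightarrow> loop_at X b q \<Longrightarrow> loop_at X b (loop_join p q)"
  by (simp add: loop_at_def pathin_loop_join) (simp add: loop_join_def)

text \<open>
  Closing up every simplex of \<open>c\<close> by the paths \<open>\<gamma>\<close> from the base point turns it into a loop; the
  corrections add up to the cone over the boundary of \<open>c\<close>.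
\<close>

lemma chain_homologous_loop:
  assumes b: "b \<in> topspace X"
    and \<gamma>: "\<And>y. y \<in> topspace X \<Longrightarrow> pathin X (\<gamma> y) \<and> \<gamma> y 0 = b \<and> \<gamma> y 1 = y"
    and c: "singular_chain 1 X c"
  obtains p where "loop_at X b p"
    and "homologous_rel 1 X {} (c - cone_chain \<gamma> (chain_boundary 1 c)) (path_chain p)"
proof -
  let ?D = "\<lambda>c. c - cone_chain \<gamma> (chain_boundary 1 c)"
  have "Poly_Mapping.keys c \<subseteq> singular_simplex_set 1 X"
    using c by (simp add: singular_chain_def)
  then have "\<exists>p. loop_at X b p \<and> homologous_rel 1 X {} (?D c) (path_chain p)"
  proof (induction c rule: frag_induction)
    case zero
    have "homologous_rel 1 X {} 0 (path_chain (\<lambda>t. b))"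
      using homologous_const_path[OF b] by (simp add: homologous_rel_sym)
    then show ?case
      using b by (intro exI[of _ "\<lambda>t. b"]) (simp add: loop_at_def)
  next
    case (one f)
    then obtain s where s: "pathin X s" "f = path_simplex s"
      using singular_simplex_1_path by blast
    have ends: "s 0 \<in> topspace X" "s 1 \<in> topspace X"
      using s path_start_in_topspace path_finish_in_topspace by blast+
    let ?u = "\<gamma> (s 0)" and ?v = "\<lambda>t. \<gamma> (s 1) (1 - t)"
    let ?p = "loop_join (loop_join ?u s) ?v"
    have u: "pathin X ?u" "?u 1 = s 0" and v: "pathin X ?v" "?v 0 = s 1"
      using \<gamma>[OF ends(1)] \<gamma>[OF ends(2)] by (auto intro: pathin_reverse)
    have us: "pathin X (loop_join ?u s)" "loop_join ?u s 1 = ?v 0"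
      using u s v pathin_loop_join by (auto simp: loop_join_def)
    have "loop_at X b ?p"
      unfolding loop_at_def
      using pathin_loop_join[OF us(1) v(1) us(2)] \<gamma>[OF ends(1)] \<gamma>[OF ends(2)]
      by (simp add: loop_join_def)
    moreover have h1: "homologous_rel 1 X {} (path_chain ?p) (path_chain (loop_join ?u s) + path_chain ?v)"
      by (rule homologous_loop_join[OF us(1) v(1) us(2)])
    have h2: "homologous_rel 1 X {} (path_chain (loop_join ?u s) + path_chain ?v)
        ((path_chain ?u + path_chain s) + - path_chain (\<gamma> (s 1)))"
      using \<gamma>[OF ends(2)]
      by (intro homologous_rel_add homologous_loop_join homologous_reverse u s) auto
    \<comment> \<open>The boundary is end minus start, so subtracting its cone adds the path to
      \<open>s 0\<close> and takes away the path to \<open>s 1\<close>.\<close>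
    have D: "(path_chain ?u + path_chain s) + - path_chain (\<gamma> (s 1)) = ?D (frag_of f)"
      unfolding s(2) chain_boundary_path_chain cone_chain_diff cone_chain_vertex by simp
    have "homologous_rel 1 X {} (?D (frag_of f)) (path_chain ?p)"
      using homologous_rel_symD[OF homologous_rel_trans'[OF h1 h2]] unfolding D .
    ultimately show ?case by blast
  next
    case (diff c d)
    then obtain p q where p: "loop_at X b p" "homologous_rel 1 X {} (?D c) (path_chain p)"
      and q: "loop_at X b q" "homologous_rel 1 X {} (?D d) (path_chain q)"
      by blast
    \<comment> \<open>\<open>frag_induction\<close> builds chains by differences, so the second loop
      enters reversed; the common base point makes the join a loop.\<close>
    let ?r = "loop_join p (\<lambda>t. q (1 - t))"
    have r: "loop_at X b ?r"
      using p q by (intro loop_at_join loop_at_reverse)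
    have h1: "homologous_rel 1 X {} (path_chain ?r) (path_chain p + path_chain (\<lambda>t. q (1 - t)))"
      using p q by (intro homologous_loop_join) (auto simp: loop_at_def pathin_reverse)
    have h2: "homologous_rel 1 X {} (path_chain p + path_chain (\<lambda>t. q (1 - t))) (path_chain p + - path_chain q)"
      using q by (intro homologous_rel_add homologous_reverse) (auto simp: loop_at_def)
    have h3: "homologous_rel 1 X {} (path_chain p + - path_chain q) (?D (c - d))"
    proof -
      have D: "?D (c - d) = ?D c - ?D d"
        by (simp add: chain_boundary_diff cone_chain_diff)
      show ?thesis
        unfolding D add_uminus_conv_diff
        by (rule homologous_rel_diff[OF p(2) q(2), THEN homologous_rel_symD])
    qed
    have "homologous_rel 1 X {} (?D (c - d)) (path_chain ?r)"
      by (rule homologous_rel_symD[OF homologous_rel_trans'[OF h1 homologous_rel_trans'[OF h2 h3]]])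
    with r show ?case by blast
  qed
  then show thesis using that by blast
qed

text \<open>The boundary of a cycle is 0, so the cone correction of
  \<open>chain_homologous_loop\<close> vanishes.\<close>

lemma cycle_homologous_loop:
  assumes "path_connected_space X" "b \<in> topspace X" "singular_relcycle 1 X {} c"
  obtains p where "loop_at X b p" "homologous_rel 1 X {} c (path_chain p)"
proof -
  have "\<forall>y\<in>topspace X. \<exists>g. pathin X g \<and> g 0 = b \<and> g 1 = y"
    using assms by (auto simp: path_connected_space_def)
  then obtain \<gamma> where "\<And>y. y \<in> topspace X \<Longrightarrow> pathin X (\<gamma> y) \<and> \<gamma> y 0 = b \<and> \<gamma> y 1 = y"
    by metis
  from chain_homologous_loop[OF assms(2) this, of c] show thesis
    using assms(3) that unfolding singular_cycle by (metis cone_chain_0 diff_zero)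
qed

text \<open>The contraction applied to the loop is a square. Its two vertical sides both trace the
  motion of the base point, which need not be constant, and cancel; the side opposite to
  \<open>p\<close> is constant.\<close>

lemma loop_null_homologous:
  assumes "contractible_space X" "loop_at X b p"
  shows "homologous_rel 1 X {} (path_chain p) 0"
proof -
  obtain a h where h: "continuous_map (prod_topology (top_of_set {0..1::real}) X) X h"
      and h0: "\<And>x. h (0, x) = x" and h1: "\<And>x. h (1, x) = a"
    using assms(1) unfolding contractible_space_def homotopic_with_def by auto
  have p: "continuous_map (top_of_set {0..1}) X p" "p 0 = b" "p 1 = b"
    using assms(2) by (auto simp: loop_at_def pathin_def)
  have "continuous_map (top_of_set ({0..1::real} \<times> {0..1::real})) (prod_topology (top_of_set {0..1}) X) (\<lambda>x. (snd x, p (fst x)))"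
  proof -
    have "continuous_map (top_of_set ({0..1::real} \<times> {0..1::real})) (top_of_set {0..1}) fst"
      "continuous_map (top_of_set ({0..1::real} \<times> {0..1::real})) (top_of_set {0..1}) snd"
      by (auto simp: continuous_map_in_subtopology intro!: continuous_intros)
    with continuous_map_compose[OF this(1) p(1)] show ?thesis
      by (simp add: continuous_map_pairedI o_def)
  qed
  from continuous_map_compose[OF this h]
  have "continuous_map (top_of_set ({0..1} \<times> {0..1})) X (\<lambda>x. h (snd x, p (fst x)))"
    by (simp add: o_def)
  from homologous_square[OF this]
  have "homologous_rel 1 X {} (path_chain p) (path_chain (\<lambda>t. a))"
    by (simp add: h0 h1 p homologous_rel_def)
  moreover have "a \<in> topspace X"
  proof -
    have "h (1, b) \<in> topspace X"
      using h path_start_in_topspace[of X p] p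
      unfolding continuous_map_def pathin_def by (auto simp: Pi_iff)
    then show ?thesis by (simp add: h1)
  qed
  ultimately show ?thesis
    by (blast intro: homologous_rel_trans[OF homologous_const_path])
qed

section \<open>Moving a cycle off one point\<close>

lemma homologous_rel_mono:
  assumes "homologous_rel p (subtopology X S) {} a b"
  shows "homologous_rel p X {} a b"
  using singular_boundary_mono[of S UNIV p X] assms by (simp add: homologous_rel_def)

text \<open>
  This is the vanishing of \<open>H\<^sub>1(X, X - q)\<close> in terms of cycles: by excision the part of the cycle near
  \<open>q\<close> may be taken inside \<open>U\<close>, and there it is homologous to any chain in \<open>U - q\<close> that has the same
  boundary.
\<close>

lemma cycle_homologous_avoiding_point:
  assumes c: "singular_relcycle 1 X {} c"
    and U: "openin X U" "q \<in> U" and q: "closedin X {q}"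
    and contr: "contractible_space (subtopology X U)"
    and pc: "path_connected_space (subtopology X (U - {q}))" and ne: "U - {q} \<noteq> {}"
  obtains d where "singular_relcycle 1 (subtopology X (topspace X - {q})) {} d"
    and "homologous_rel 1 X {} c d"
proof -
  let ?T = "topspace X - {q}" and ?W = "subtopology X U"
  have UX: "U \<subseteq> topspace X" using U openin_subset by blast
  have eqs: "topspace X - (topspace X - U) = U" "?T - (topspace X - U) = U - {q}"
    using UX by auto
  \<comment> \<open>The complement of \<open>U\<close> is excised: it is closed and misses
    \<open>q\<close>, and the pair that remains is \<open>(U, U - {q})\<close>.\<close>
  have "X closure_of (topspace X - U) \<subseteq> X interior_of ?T"
  proof -
    have "X closure_of (topspace X - U) = topspace X - U"
      using U(1) by (intro closure_of_closedin) auto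
    moreover have "X interior_of ?T = ?T"
      using q by (intro interior_of_openin) auto
    ultimately show ?thesis using U(2) by auto
  qed
  moreover have "singular_relcycle 1 (subtopology X (topspace X)) ?T c"
    using c unfolding singular_cycle by (simp add: singular_relcycle)
  ultimately obtain c1 where c1: "singular_relcycle 1 ?W (U - {q}) c1"
      and cc1: "homologous_rel 1 X ?T c c1"
    using excised_relcycle_exists[of X "topspace X - U" ?T "topspace X" 1 c] unfolding eqs by auto
  obtain d e where d: "singular_chain (Suc 1) X d" and e: "singular_chain 1 (subtopology X ?T) e"
      and de: "chain_boundary (Suc 1) d + e = c - c1"
    using cc1 unfolding homologous_rel_def singular_relboundary by blast
  have c1W: "singular_chain 1 ?W c1"
    and "singular_chain 0 (subtopology ?W (U - {q})) (chain_boundary 1 c1)"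
    using c1 by (auto simp: singular_relcycle)
  then have bc1: "singular_chain 0 (subtopology X (U - {q})) (chain_boundary 1 c1)"
    by (simp add: subtopology_subtopology Int_absorb1 Diff_subset)
  obtain b where b: "b \<in> U - {q}" using ne by blast
  \<comment> \<open>\<open>chain_homologous_loop\<close> asks for a path to every point of
    \<open>U\<close>, including \<open>q\<close>; all the other paths are chosen off
    \<open>q\<close>, so that the cone over points different from \<open>q\<close> avoids
    it.\<close>
  have "\<exists>g. pathin ?W g \<and> g 0 = b \<and> g 1 = y \<and> (y \<noteq> q \<longrightarrow> pathin (subtopology X (U - {q})) g)"
    if y: "y \<in> U" for y
  proof (cases "y = q")
    case True
    then show ?thesis
      using contractible_imp_path_connected_space[OF contr] b y UX
      unfolding path_connected_space_def by auto
  next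
    case False
    with b y UX have "b \<in> topspace (subtopology X (U - {q}))" "y \<in> topspace (subtopology X (U - {q}))"
      by auto
    with pc obtain g where "pathin (subtopology X (U - {q})) g" "g 0 = b" "g 1 = y"
      unfolding path_connected_space_def by blast
    moreover from this have "pathin ?W g"
      by (auto simp: pathin_subtopology)
    ultimately show ?thesis by blast
  qed
  then obtain \<gamma> where \<gamma>: "\<And>y. y \<in> U \<Longrightarrow> pathin ?W (\<gamma> y) \<and> \<gamma> y 0 = b \<and> \<gamma> y 1 = y"
      and \<gamma>': "\<And>y. y \<in> U \<Longrightarrow> y \<noteq> q \<Longrightarrow> pathin (subtopology X (U - {q})) (\<gamma> y)"
    by metis
  have bW: "b \<in> topspace ?W" using b UX by auto
  obtain p where p: "loop_at ?W b p"
      and hp: "homologous_rel 1 ?W {} (c1 - cone_chain \<gamma> (chain_boundary 1 c1)) (path_chain p)"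
    using chain_homologous_loop[OF bW _ c1W, of \<gamma>] \<gamma> by auto
  \<comment> \<open>The replacement for \<open>c1\<close>: it stays off \<open>q\<close> because the
    boundary of \<open>c1\<close> does, and \<open>c1 - k\<close> is homologous to a loop in the
    contractible \<open>U\<close>, hence to 0.\<close>
  define k where "k = cone_chain \<gamma> (chain_boundary 1 c1)"
  have "homologous_rel 1 ?W {} (c1 - k) 0"
    using homologous_rel_trans[OF loop_null_homologous[OF contr p]] hp by (simp add: k_def)
  from homologous_rel_mono[OF this] have c1k: "homologous_rel 1 X {} c1 k"
    by (simp add: homologous_rel_def)
  have "singular_chain 1 (subtopology X (U - {q})) k"
    unfolding k_def using \<gamma>' by (intro singular_chain_cone_chain[OF bc1]) auto
  then have "singular_chain 1 (subtopology X ?T) k"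
    by (rule singular_chain_mono) (use UX in blast)
  then have ke: "singular_chain 1 (subtopology X ?T) (k + e)"
    using e singular_chain_add by blast
  have "homologous_rel 1 X {} (c1 + e) (k + e)"
    using c1k by (intro homologous_rel_add) auto
  moreover have "homologous_rel 1 X {} c (c1 + e)"
    unfolding homologous_rel_def singular_boundary using d de
    by (intro exI[of _ d]) (simp add: algebra_simps)
  ultimately have hom: "homologous_rel 1 X {} c (k + e)"
    using homologous_rel_trans by blast
  \<comment> \<open>Being a cycle is inherited from \<open>c\<close> through the homology in
    \<open>X\<close>; since both summands are chains of the complement, the sum is a cycle
    there.\<close>
  then have "singular_relcycle 1 X {} (k + e)"
    using c homologous_rel_singular_relcycle by blast
  with ke have "singular_relcycle 1 (subtopology X ?T) {} (k + e)"
    by (simp add: singular_cycle)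
  with hom show thesis using that by blast
qed

section \<open>Avoiding finitely many points of a surface\<close>

text \<open>The chart condition of \<open>closed_surface\<close>, separated from compactness so that
  it can pass to open subspaces.\<close>

definition locally_planar :: "'a topology \<Rightarrow> bool" where
  "locally_planar X \<longleftrightarrow>
     (\<forall>y\<in>topspace X. \<exists>U (V :: (real^2) set).
        openin X U \<and> y \<in> U \<and> open V \<and> subtopology X U homeomorphic_space top_of_set V)"

lemma locally_planar_open_subtopology:
  assumes X: "locally_planar X" and W: "openin X W"
  shows "locally_planar (subtopology X W)"
  unfolding locally_planar_def
proof
  fix y assume y: "y \<in> topspace (subtopology X W)"
  then obtain U and V :: "(real^2) set" where UV: "openin X U" "y \<in> U" "open V"
      "subtopology X U homeomorphic_space top_of_set V"
    using X unfolding locally_planar_def by auto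
  then obtain f where f: "homeomorphic_map (subtopology X U) (top_of_set V) f"
    using homeomorphic_space by blast
  have UX: "U \<subseteq> topspace X" using UV openin_subset by blast
  have fU: "f ` U = V"
    using homeomorphic_imp_surjective_map[OF f] UX by (simp add: Int_absorb1)
  have "openin (subtopology X U) (U \<inter> W)"
    using W openin_subtopology_Int2 by blast
  then have "openin (top_of_set V) (f ` (U \<inter> W))"
    using homeomorphic_imp_open_map[OF f] by (simp add: open_map_def)
  then have o: "open (f ` (U \<inter> W))"
    using UV(3) openin_open_trans by blast
  have "homeomorphic_map (subtopology (subtopology X U) W) (subtopology (top_of_set V) (f ` (U \<inter> W))) f"
    using UX fU by (intro homeomorphic_map_subtopologies[OF f]) auto
  moreover have "V \<inter> f ` (U \<inter> W) = f ` (U \<inter> W)"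
    using fU by blast
  then have "subtopology (top_of_set V) (f ` (U \<inter> W)) = top_of_set (f ` (U \<inter> W))"
    by (simp add: subtopology_subtopology)
  moreover have "subtopology (subtopology X U) W = subtopology (subtopology X W) (U \<inter> W)"
    by (simp add: subtopology_subtopology Int_ac)
  ultimately have "subtopology (subtopology X W) (U \<inter> W) homeomorphic_space top_of_set (f ` (U \<inter> W))"
    using homeomorphic_space by fastforce
  moreover have "openin (subtopology X W) (U \<inter> W)"
    using UV(1) openin_subtopology_Int by blast
  ultimately show "\<exists>U (V :: (real^2) set). openin (subtopology X W) U \<and> y \<in> U \<and> open V \<and>
      subtopology (subtopology X W) U homeomorphic_space top_of_set V"
    using o y UV(2) by auto
qed

text \<open>The preimage of a round ball in a chart: the ball is convex, hence contractible.\<close>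

lemma locally_planar_disc:
  assumes X: "locally_planar X" and y: "y \<in> topspace X"
  obtains U where "openin X U" "y \<in> U" "contractible_space (subtopology X U)"
    "path_connected_space (subtopology X (U - {y}))" "U - {y} \<noteq> {}"
proof -
  obtain U and V :: "(real^2) set" where UV: "openin X U" "y \<in> U" "open V"
      "subtopology X U homeomorphic_space top_of_set V"
    using X y unfolding locally_planar_def by auto
  then obtain f g where fg: "homeomorphic_maps (subtopology X U) (top_of_set V) f g"
    using homeomorphic_space_def by blast
  have UX: "U \<subseteq> topspace X" using UV openin_subset by blast
  then have tU: "topspace (subtopology X U) = U" by auto
  have f: "homeomorphic_map (subtopology X U) (top_of_set V) f"
    using fg homeomorphic_maps_map by blast
  have fU: "f ` U = V" and inj: "inj_on f U"
    using homeomorphic_imp_surjective_map[OF f] homeomorphic_imp_injective_map[OF f] tU by simp_all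
  have "f y \<in> V" using fU UV(2) by blast
  then obtain r where r: "r > 0" "ball (f y) r \<subseteq> V"
    using UV(3) open_contains_ball by blast
  define D where "D = {z \<in> U. f z \<in> ball (f y) r}"
  have DU: "D \<subseteq> U" by (auto simp: D_def)
  have fD: "f ` D = ball (f y) r"
    using r fU unfolding D_def by blast
  have yD: "y \<in> D" using UV(2) r by (simp add: D_def)
  have fD': "f ` (D - {y}) = ball (f y) r - {f y}"
    using inj_on_image_set_diff[OF inj, of D "{y}"] DU fD UV(2) by auto
  have hom: "subtopology X S homeomorphic_space top_of_set (f ` S)" if "S \<subseteq> U" for S
  proof -
    have "homeomorphic_map (subtopology (subtopology X U) S) (subtopology (top_of_set V) (f ` S)) f"
      using UX fU that by (intro homeomorphic_map_subtopologies[OF f]) auto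
    moreover have "subtopology (top_of_set V) (f ` S) = top_of_set (f ` S)"
      using fU that by (auto simp: subtopology_subtopology Int_absorb1 image_mono)
    moreover have "subtopology (subtopology X U) S = subtopology X S"
      using that by (simp add: subtopology_subtopology Int_absorb1)
    ultimately show ?thesis using homeomorphic_space by fastforce
  qed
  have "openin (subtopology X U) {z \<in> topspace (subtopology X U). f z \<in> ball (f y) r}"
    using homeomorphic_imp_continuous_map[OF f]
    by (intro openin_continuous_map_preimage[of _ "euclidean"])
      (auto simp: continuous_map_in_subtopology simp flip: open_openin)
  then have oD: "openin X D"
    using UV(1) openin_trans_full unfolding tU D_def by blast
  \<comment> \<open>Dimension two enters here: a point disconnects a convex set of dimension 1,
    whereas the punctured planar ball stays path connected.\<close>
  have aff: "aff_dim (ball (f y) r) \<noteq> 1"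
    using r by (simp add: aff_dim_open)
  show thesis
  proof
    show "openin X D" "y \<in> D" by fact+
    show "contractible_space (subtopology X D)"
      using homeomorphic_space_contractibility[OF hom[OF DU]] fD
      by (simp add: convex_imp_contractible)
    have "path_connected_space (top_of_set (f ` (D - {y})))"
      unfolding fD' using path_connected_punctured_convex[OF convex_ball aff]
      by (metis path_connectedin_def path_connectedin_euclidean)
    then show "path_connected_space (subtopology X (D - {y}))"
      using homeomorphic_path_connected_space[OF hom[of "D - {y}"]] DU by blast
    have "ball (f y) r - {f y} \<noteq> {}"
    proof
      assume "ball (f y) r - {f y} = {}"
      then have "ball (f y) r \<subseteq> {f y}" by blast
      then have "finite (ball (f y) r)" using finite_subset by blast
      then show False using r uncountable_ball[of r "f y"] uncountable_infinite by blast
    qed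
    then show "D - {y} \<noteq> {}" using fD' by blast
  qed
qed

text \<open>Arbitrarily small discs come from applying \<open>locally_planar_disc\<close> to the
  open subspace \<open>W\<close> itself.\<close>

lemma locally_planar_imp_locally_path_connected:
  assumes "locally_planar X"
  shows "locally_path_connected_space X"
  unfolding locally_path_connected_space_def neighbourhood_base_of
proof (intro allI impI)
  fix W y assume "openin X W \<and> y \<in> W"
  then have W: "openin X W" "y \<in> W" "W \<subseteq> topspace X" using openin_subset by auto
  then obtain U where U: "openin (subtopology X W) U" "y \<in> U" "contractible_space (subtopology (subtopology X W) U)"
    using locally_planar_disc[OF locally_planar_open_subtopology[OF assms W(1)], of y] by auto
  then have UW: "U \<subseteq> W" "openin X U" using W openin_trans_full openin_subset by fastforce+
  then have "path_connected_space (subtopology X U)"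
    using contractible_imp_path_connected_space[OF U(3)] by (simp add: subtopology_subtopology Int_absorb1)
  then have "path_connectedin X U" using UW W by (simp add: path_connectedin_def)
  then show "\<exists>U V. openin X U \<and> path_connectedin X V \<and> y \<in> U \<and> U \<subseteq> V \<and> V \<subseteq> W"
    using U UW by blast
qed

section \<open>Deleting finitely many points from a locally planar space\<close>

lemma connected_spaceD:
  assumes "connected_space X" "openin X A" "openin X B" "A \<union> B = topspace X" "A \<inter> B = {}"
  shows "A = {} \<or> B = {}"
  using assms unfolding connected_space_eq by blast

text \<open>If \<open>A\<close> and \<open>B\<close> separated the complement, the connected
  punctured disc around \<open>q\<close> would lie in one of them. Adding \<open>q\<close> to that
  side keeps it open and separates \<open>X\<close>.\<close>

lemma connected_space_remove_point:
  assumes X: "locally_planar X" "connected_space X" and q: "closedin X {q}"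
  shows "connected_space (subtopology X (topspace X - {q}))"
  unfolding connected_space_eq
proof (rule notI, elim exE conjE)
  let ?Y = "subtopology X (topspace X - {q})"
  have qX: "q \<in> topspace X" using q closedin_subset by fastforce
  have oY: "openin X (topspace X - {q})" using q by blast
  fix A B
  assume A: "openin ?Y A" "A \<noteq> {}" and B: "openin ?Y B" "B \<noteq> {}"
    and un: "A \<union> B = topspace ?Y" and dis: "A \<inter> B = {}"
  obtain U where U: "openin X U" "q \<in> U" "path_connected_space (subtopology X (U - {q}))"
    using locally_planar_disc[OF X(1) qX] by blast
  have UX: "U \<subseteq> topspace X" using U openin_subset by blast
  have AX: "openin X A" and BX: "openin X B"
    using A B oY openin_trans_full by blast+
  have un': "A \<union> B = topspace X - {q}" using un by auto
  have con: "connectedin X (U - {q})"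
    using U(3) UX by (auto simp: connectedin_def path_connected_imp_connected_space)
  have "U \<inter> A - {q} = {} \<or> U \<inter> B - {q} = {}"
    using con AX BX un' dis UX unfolding connectedin by blast
  then show False
  proof
    assume "U \<inter> A - {q} = {}"
    then have "U \<union> B = B \<union> {q}" "A \<inter> (B \<union> {q}) = {}" using un' UX U(2) dis by auto
    moreover have "openin X (U \<union> B)" using U BX by blast
    moreover have "A \<union> (B \<union> {q}) = topspace X" using un' qX by auto
    ultimately have "A = {} \<or> B \<union> {q} = {}"
      using connected_spaceD[OF X(2) AX, of "B \<union> {q}"] by simp
    then show False using A by simp
  next
    assume "U \<inter> B - {q} = {}"
    then have "U \<union> A = A \<union> {q}" "B \<inter> (A \<union> {q}) = {}" using un' UX U(2) dis by auto
    moreover have "openin X (U \<union> A)" using U AX by blast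
    moreover have "B \<union> (A \<union> {q}) = topspace X" using un' qX by auto
    ultimately have "B = {} \<or> A \<union> {q} = {}"
      using connected_spaceD[OF X(2) BX, of "A \<union> {q}"] by simp
    then show False using B by simp
  qed
qed

lemma t1_space_openin_minus_finite:
  assumes "t1_space X" "finite Q"
  shows "openin X (topspace X - Q)"
proof -
  have "closedin X (topspace X \<inter> Q)"
    using assms by (simp add: t1_space_closedin_finite)
  then have "openin X (topspace X - topspace X \<inter> Q)" by blast
  then show ?thesis by (simp add: Diff_Int)
qed

text \<open>The one-point results are applied to \<open>?Y\<close>, the space without the earlier
  points, and the homology found there is pushed forward to \<open>X\<close>. Connectedness shares
  the induction because its own step needs \<open>?Y\<close> connected.\<close>

lemma cycle_homologous_avoiding_finite:
  assumes X: "locally_planar X" "connected_space X" "t1_space X" and Q: "finite Q"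
    and c: "singular_relcycle 1 X {} c"
  shows "connected_space (subtopology X (topspace X - Q)) \<and>
    (\<exists>d. singular_relcycle 1 (subtopology X (topspace X - Q)) {} d \<and> homologous_rel 1 X {} c d)"
  using Q
proof (induction Q)
  case empty
  then show ?case using X c by auto
next
  case (insert q Q)
  let ?Y = "subtopology X (topspace X - Q)"
  have eq: "topspace X - insert q Q = topspace ?Y - {q}" by auto
  have eq': "subtopology X (topspace X - insert q Q) = subtopology ?Y (topspace ?Y - {q})"
  proof -
    have "(topspace X - Q) \<inter> (topspace ?Y - {q}) = topspace X - insert q Q" by auto
    then show ?thesis by (simp only: subtopology_subtopology)
  qed
  from insert.IH obtain d where d: "connected_space ?Y" "singular_relcycle 1 ?Y {} d" "homologous_rel 1 X {} c d"
    by blast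
  show ?case
  proof (cases "q \<in> topspace ?Y")
    \<comment> \<open>\<open>Q\<close> is an arbitrary finite set; deleting something that is not a
      point of the space changes nothing.\<close>
    case False
    then have "topspace ?Y - {q} = topspace ?Y" by blast
    then have "subtopology X (topspace X - insert q Q) = ?Y"
      unfolding eq' by (simp only: subtopology_topspace)
    then show ?thesis using d by metis
  next
    case True
    have "openin X (topspace X - Q)"
      using X(3) insert.hyps(1) by (rule t1_space_openin_minus_finite)
    then have Y: "locally_planar ?Y"
      by (rule locally_planar_open_subtopology[OF X(1)])
    have q: "closedin ?Y {q}"
      using X(3) True t1_space_subtopology closedin_t1_singleton by metis
    obtain U where U: "openin ?Y U" "q \<in> U" "contractible_space (subtopology ?Y U)"
        "path_connected_space (subtopology ?Y (U - {q}))" "U - {q} \<noteq> {}"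
      using locally_planar_disc[OF Y True] by blast
    obtain e where e: "singular_relcycle 1 (subtopology ?Y (topspace ?Y - {q})) {} e" "homologous_rel 1 ?Y {} d e"
      using cycle_homologous_avoiding_point[OF d(2) U(1,2) q U(3-5)] by blast
    have "homologous_rel 1 X {} c e"
      using d(3) homologous_rel_mono[OF e(2)] homologous_rel_trans by blast
    then show ?thesis
      unfolding eq' using e(1) connected_space_remove_point[OF Y d(1) q] by blast
  qed
qed

text \<open>Connecting paths from \<open>b\<close> exist in the complement because it is connected
  and, being open, locally path connected.\<close>

lemma cycle_homologous_loop_avoiding_finite:
  assumes X: "locally_planar X" "connected_space X" "t1_space X" and Q: "finite Q"
    and c: "singular_relcycle 1 X {} c" and b: "b \<in> topspace X - Q"
  obtains p where "loop_at (subtopology X (topspace X - Q)) b p" "homologous_rel 1 X {} c (path_chain p)"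
proof -
  let ?Y = "subtopology X (topspace X - Q)"
  obtain d where d: "connected_space ?Y" "singular_relcycle 1 ?Y {} d" "homologous_rel 1 X {} c d"
    using cycle_homologous_avoiding_finite[OF X Q c] by blast
  have "openin X (topspace X - Q)"
    using X(3) Q by (rule t1_space_openin_minus_finite)
  then have "locally_path_connected_space ?Y"
    using locally_planar_open_subtopology[OF X(1)] locally_planar_imp_locally_path_connected by blast
  then have "path_connected_space ?Y"
    using d(1) path_connected_eq_connected_space by blast
  then obtain p where p: "loop_at ?Y b p" "homologous_rel 1 ?Y {} d (path_chain p)"
    using cycle_homologous_loop[of ?Y b d] d(2) b by auto
  then show thesis
    using that[OF p(1)] d(3) homologous_rel_mono[OF p(2)] homologous_rel_trans by blast
qed

section \<open>Path and homotopy lifting\<close>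

text \<open>The features of a covering map that lifting uses. The set \<open>W\<close> depends on
  \<open>b\<close> alone and serves every point lying over it, so a map into \<open>W\<close> is
  lifted with any prescribed value by composing it with a section. The first two conditions give
  uniqueness.\<close>

locale sectioned_map =
  fixes E :: "'a topology" and B :: "'b topology" and p :: "'a \<Rightarrow> 'b"
  assumes Hausdorff: "Hausdorff_space E"
    and locally_inj: "\<And>e. e \<in> topspace E \<Longrightarrow> \<exists>V. openin E V \<and> e \<in> V \<and> inj_on p V"
    and sections: "\<And>b. b \<in> topspace B \<Longrightarrow> \<exists>W. openin B W \<and> b \<in> W \<and>
      (\<forall>e\<in>topspace E. p e \<in> W \<longrightarrow>
        (\<exists>s. continuous_map (subtopology B W) E s \<and> s (p e) = e \<and> (\<forall>w\<in>W. p (s w) = w)))"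
begin

text \<open>The set where two lifts agree is closed as \<open>E\<close> is Hausdorff and open as
  \<open>p\<close> is locally injective.\<close>

lemma lifts_agree:
  assumes Z: "connected_space Z" and fg: "continuous_map Z E f" "continuous_map Z E g"
    and eq: "\<And>z. z \<in> topspace Z \<Longrightarrow> p (f z) = p (g z)"
    and a: "a \<in> topspace Z" "f a = g a" and z: "z \<in> topspace Z"
  shows "f z = g z"
proof -
  let ?A = "{z \<in> topspace Z. f z = g z}"
  have "closedin Z ?A"
    using Hausdorff fg by (intro closedin_continuous_maps_eq)
  moreover have "openin Z ?A"
  proof (subst openin_subopen, intro ballI)
    fix z assume z: "z \<in> ?A"
    then have "f z \<in> topspace E"
      using fg(1) unfolding continuous_map_def Pi_iff by blast
    then obtain V where V: "openin E V" "f z \<in> V" "inj_on p V"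
      using locally_inj by blast
    let ?T = "{z \<in> topspace Z. f z \<in> V} \<inter> {z \<in> topspace Z. g z \<in> V}"
    have "openin Z ?T"
      using fg V(1) openin_continuous_map_preimage by blast
    moreover have "z \<in> ?T" using z V(2) by auto
    moreover have "?T \<subseteq> ?A"
      using V(3) eq by (auto dest: inj_onD)
    ultimately show "\<exists>T. openin Z T \<and> z \<in> T \<and> T \<subseteq> ?A" by blast
  qed
  ultimately have "?A = topspace Z"
    using Z a unfolding connected_space_clopen_in by blast
  then show ?thesis using z by blast
qed

text \<open>Lifts with every admissible value at every point are demanded so that a lift on one
  piece can be continued to the next from whatever value it reaches.\<close>

definition liftable :: "(real \<times> real \<Rightarrow> 'b) \<Rightarrow> (real \<times> real) set \<Rightarrow> bool" where
  "liftable h S \<longleftrightarrow> (\<forall>z\<in>S. \<forall>e\<in>topspace E. p e = h z \<longrightarrow>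
     (\<exists>k. continuous_map (top_of_set S) E k \<and> (\<forall>w\<in>S. p (k w) = h w) \<and> k z = e))"

text \<open>The lift on \<open>S\<close> supplies the starting value for \<open>T\<close> at a
  common point; uniqueness on the connected intersection makes the two lifts fit together, and
  closedness makes the result continuous.\<close>

lemma liftable_Un_aux:
  assumes S: "liftable h S" "closed S" and T: "liftable h T" "closed T"
    and con: "connected (S \<inter> T)" "S \<inter> T \<noteq> {}"
    and z: "z \<in> S" and e: "e \<in> topspace E" "p e = h z"
  shows "\<exists>k. continuous_map (top_of_set (S \<union> T)) E k \<and> (\<forall>w\<in>S \<union> T. p (k w) = h w) \<and> k z = e"
proof -
  obtain k where k: "continuous_map (top_of_set S) E k" "\<forall>w\<in>S. p (k w) = h w" "k z = e"
    using S(1) z e unfolding liftable_def by blast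
  obtain y where y: "y \<in> S" "y \<in> T" using con(2) by blast
  have "k y \<in> topspace E" using k(1) y by (auto simp: continuous_map_def)
  then obtain l where l: "continuous_map (top_of_set T) E l" "\<forall>w\<in>T. p (l w) = h w" "l y = k y"
    using T(1) y k(2) unfolding liftable_def by metis
  have agree: "k w = l w" if "w \<in> S \<inter> T" for w
  proof (rule lifts_agree[where Z = "top_of_set (S \<inter> T)" and f = k and g = l and a = y])
    show "connected_space (top_of_set (S \<inter> T))"
      using con(1) by (metis connectedin_def connectedin_iff_connected)
    show "continuous_map (top_of_set (S \<inter> T)) E k" "continuous_map (top_of_set (S \<inter> T)) E l"
      using continuous_map_from_subtopology_mono[OF k(1)] continuous_map_from_subtopology_mono[OF l(1)]
      by blast+
  qed (use k l y that in auto)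
  let ?m = "\<lambda>w. if w \<in> S then k w else l w"
  have "continuous_map (top_of_set (S \<union> T)) E ?m"
  proof (rule pasting_lemma_closed[where I = UNIV and T = "\<lambda>i. if i then S else T" and f = "\<lambda>i. if i then k else l"])
    show "closedin (top_of_set (S \<union> T)) (if i then S else T)" for i
      using S(2) T(2) by (auto intro: closed_subset)
    show "continuous_map (subtopology (top_of_set (S \<union> T)) (if i then S else T)) E (if i then k else l)" for i
      using k(1) l(1) by (simp add: subtopology_subtopology Int_absorb1)
  next
    fix i j w
    assume "w \<in> topspace (top_of_set (S \<union> T)) \<inter> (if i then S else T) \<inter> (if j then S else T)"
    then show "(if i then k else l) w = (if j then k else l) w"
      using agree by (cases i; cases j) auto
  next
    fix w assume "w \<in> topspace (top_of_set (S \<union> T))"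
    then show "\<exists>j. j \<in> UNIV \<and> w \<in> (if j then S else T) \<and> (if w \<in> S then k w else l w) = (if j then k else l) w"
      by (intro exI[of _ "w \<in> S"]) auto
  qed simp
  moreover have "\<forall>w\<in>S \<union> T. p (?m w) = h w" "?m z = e"
    using k l z by auto
  ultimately show ?thesis by blast
qed

lemma liftable_Un:
  assumes "liftable h S" "closed S" "liftable h T" "closed T" "connected (S \<inter> T)" "S \<inter> T \<noteq> {}"
  shows "liftable h (S \<union> T)"
  unfolding liftable_def
proof (intro ballI impI)
  fix z e assume *: "z \<in> S \<union> T" "e \<in> topspace E" "p e = h z"
  show "\<exists>k. continuous_map (top_of_set (S \<union> T)) E k \<and> (\<forall>w\<in>S \<union> T. p (k w) = h w) \<and> k z = e"
  proof (cases "z \<in> S")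
    case True
    then show ?thesis using liftable_Un_aux assms * by blast
  next
    case False
    then have "z \<in> T" using * by blast
    from liftable_Un_aux[OF assms(3,4,1,2) _ _ this *(2,3)] show ?thesis
      using assms(5,6) by (simp add: Un_commute Int_commute)
  qed
qed

text \<open>Near \<open>xy\<close> the map takes values in one \<open>W\<close>, where composition
  with a section lifts it.\<close>

lemma liftable_local:
  assumes h: "continuous_map (top_of_set Q) B h" and xy: "xy \<in> Q"
  obtains r where "r > 0" "\<And>S. S \<subseteq> Q \<Longrightarrow> S \<subseteq> ball xy r \<Longrightarrow> liftable h S"
proof -
  have "h xy \<in> topspace B" using h xy by (auto simp: continuous_map_def)
  then obtain W where W: "openin B W" "h xy \<in> W" and sec: "\<And>e. e\<in>topspace E \<Longrightarrow> p e \<in> W \<Longrightarrow>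
        \<exists>s. continuous_map (subtopology B W) E s \<and> s (p e) = e \<and> (\<forall>w\<in>W. p (s w) = w)"
    using sections by metis
  have "openin (top_of_set Q) {z \<in> topspace (top_of_set Q). h z \<in> W}"
    using openin_continuous_map_preimage[OF h W(1)] .
  moreover have "xy \<in> {z \<in> topspace (top_of_set Q). h z \<in> W}" using xy W by simp
  ultimately obtain r where r: "r > 0" "ball xy r \<inter> Q \<subseteq> {z \<in> topspace (top_of_set Q). h z \<in> W}"
    unfolding openin_contains_ball by blast
  show thesis
  proof
    show "r > 0" by fact
    fix S assume S: "S \<subseteq> Q" "S \<subseteq> ball xy r"
    have hS: "h w \<in> W" if "w \<in> S" for w using S r that by blast
    have "continuous_map (top_of_set S) B h"
      using continuous_map_from_subtopology_mono[OF h S(1)] .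
    then have hW: "continuous_map (top_of_set S) (subtopology B W) h"
      using hS by (auto simp: continuous_map_in_subtopology)
    show "liftable h S"
      unfolding liftable_def
    proof (intro ballI impI)
      fix z e assume z: "z \<in> S" and e: "e \<in> topspace E" "p e = h z"
      then obtain s where s: "continuous_map (subtopology B W) E s" "s (h z) = e" "\<forall>w\<in>W. p (s w) = w"
        using sec[of e] hS by metis
      then show "\<exists>k. continuous_map (top_of_set S) E k \<and> (\<forall>w\<in>S. p (k w) = h w) \<and> k z = e"
        using continuous_map_compose[OF hW s(1)] hS by (intro exI[of _ "s \<circ> h"]) auto
    qed
  qed
qed

text \<open>
  Subdividing the square into liftable rectangles is done by bisecting one coordinate at a time:
  here the second one, over a short interval around \<open>x\<close>.
\<close>

lemma liftable_strip:
  assumes h: "continuous_map (top_of_set ({0..1} \<times> {0..1})) B h" and x: "x \<in> {0..1}"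
  obtains d where "d > 0"
    "\<And>a b. \<lbrakk>0 \<le> a; a \<le> x; x \<le> b; b \<le> 1; b - a < d\<rbrakk> \<Longrightarrow> liftable h ({a..b} \<times> {0..1})"
proof -
  \<comment> \<open>The local case of \<open>Bolzano\<close> also ranges over intervals that stick
    out of the unit interval; the guards on \<open>c\<close> and \<open>e\<close> exclude these. The
    width \<open>d\<close> may depend on the interval, since gluing just takes a minimum.\<close>
  define P where "P \<equiv> \<lambda>c e::real. 0 \<le> c \<longrightarrow> e \<le> 1 \<longrightarrow> (\<exists>d>0. \<forall>a b. 0 \<le> a \<longrightarrow> a \<le> x \<longrightarrow> x \<le> b \<longrightarrow> b \<le> 1 \<longrightarrow> b - a < d \<longrightarrow>
      liftable h ({a..b} \<times> {c..e}))"
  have "(0::real) \<le> 1" by simp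
  then have "P 0 1"
  proof (induction rule: Bolzano)
    case (trans c e f)
    show ?case
      unfolding P_def
    proof (intro impI)
      assume cf: "0 \<le> c" "f \<le> 1"
      obtain d1 where d1: "d1 > 0" "\<And>a b. \<lbrakk>0 \<le> a; a \<le> x; x \<le> b; b \<le> 1; b - a < d1\<rbrakk> \<Longrightarrow> liftable h ({a..b} \<times> {c..e})"
        using trans cf unfolding P_def by (meson order_trans)
      obtain d2 where d2: "d2 > 0" "\<And>a b. \<lbrakk>0 \<le> a; a \<le> x; x \<le> b; b \<le> 1; b - a < d2\<rbrakk> \<Longrightarrow> liftable h ({a..b} \<times> {e..f})"
        using trans cf unfolding P_def by (meson order_trans)
      have "liftable h ({a..b} \<times> {c..f})" if "0 \<le> a" "a \<le> x" "x \<le> b" "b \<le> 1" "b - a < min d1 d2" for a b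
      proof -
        have eqs: "{a..b} \<times> {c..e} \<inter> {a..b} \<times> {e..f} = {a..b} \<times> {e}"
           "{a..b} \<times> {c..f} = {a..b} \<times> {c..e} \<union> {a..b} \<times> {e..f}"
          using trans(3,4) by auto
        show ?thesis
          unfolding eqs(2)
        proof (rule liftable_Un)
          show "connected ({a..b} \<times> {c..e} \<inter> {a..b} \<times> {e..f})" "{a..b} \<times> {c..e} \<inter> {a..b} \<times> {e..f} \<noteq> {}"
            unfolding eqs(1) using that by (auto intro: connected_Times)
        qed (use that d1 d2 in \<open>auto intro: closed_Times\<close>)
      qed
      then show "\<exists>d>0. \<forall>a b. 0 \<le> a \<longrightarrow> a \<le> x \<longrightarrow> x \<le> b \<longrightarrow> b \<le> 1 \<longrightarrow> b - a < d \<longrightarrow> liftable h ({a..b} \<times> {c..f})"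
        using d1(1) d2(1) by (intro exI[of _ "min d1 d2"]) auto
    qed
  next
    case (local y)
    then have "(x, y) \<in> {0..1} \<times> {0..1}" using x by auto
    from liftable_local[OF h this] obtain r
      where r: "r > 0" "\<And>S. S \<subseteq> {0..1} \<times> {0..1} \<Longrightarrow> S \<subseteq> ball (x, y) r \<Longrightarrow> liftable h S" by metis
    \<comment> \<open>Both sides are shorter than \<open>r / 2\<close>, so the sum of the coordinate
      distances stays below \<open>r\<close>, and with it the distance in the plane.\<close>
    have "liftable h ({a..b} \<times> {c..e})"
      if "0 \<le> a" "a \<le> x" "x \<le> b" "b \<le> 1" "b - a < r / 2" "c \<le> y" "y \<le> e" "e - c < r / 2" "0 \<le> c" "e \<le> 1" for a b c e
    proof (rule r(2))
      show "{a..b} \<times> {c..e} \<subseteq> {0..1} \<times> {0..1}" using that by auto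
      show "{a..b} \<times> {c..e} \<subseteq> ball (x, y) r"
      proof
        fix z assume z: "z \<in> {a..b} \<times> {c..e}"
        then obtain u v where uv: "z = (u, v)" "u \<in> {a..b}" "v \<in> {c..e}" by blast
        have le: "dist (x, y) (u, v) \<le> dist x u + dist y v"
          unfolding dist_prod_def by (simp add: sqrt_sum_squares_le_sum)
        have "dist x u \<le> b - a" "dist y v \<le> e - c"
          using uv that by (auto simp: dist_real_def)
        then have "dist x u + dist y v < r"
          using that by linarith
        with le show "z \<in> ball (x, y) r" using uv by simp
      qed
    qed
    then show ?case
      unfolding P_def using r(1) by (intro exI[of _ "r / 2"] conjI allI impI) auto
  qed
  then show thesis
    using that unfolding P_def by auto
qed

text \<open>Bisection of the first coordinate, with \<open>liftable_strip\<close> as local input;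
  neighbouring strips meet in a vertical segment, which is connected.\<close>

lemma liftable_square:
  assumes h: "continuous_map (top_of_set ({0..1} \<times> {0..1})) B h"
  shows "liftable h ({0..1} \<times> {0..1})"
proof -
  define P where "P \<equiv> \<lambda>a b::real. 0 \<le> a \<longrightarrow> b \<le> 1 \<longrightarrow> liftable h ({a..b} \<times> {0..1})"
  have "(0::real) \<le> 1" by simp
  then have "P 0 1"
  proof (induction rule: Bolzano)
    case (trans a b c)
    have eqs: "{a..b} \<times> {0..1::real} \<inter> {b..c} \<times> {0..1} = {b} \<times> {0..1}"
      "{a..c} \<times> {0..1::real} = {a..b} \<times> {0..1} \<union> {b..c} \<times> {0..1}"
      using trans(3,4) by auto
    show ?case
      unfolding P_def eqs(2)
    proof (intro impI)
      assume "0 \<le> a" "c \<le> 1"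
      then have l: "liftable h ({a..b} \<times> {0..1})" "liftable h ({b..c} \<times> {0..1})"
        using trans unfolding P_def by auto
      show "liftable h ({a..b} \<times> {0..1} \<union> {b..c} \<times> {0..1})"
        by (rule liftable_Un[OF l(1) _ l(2)]) (unfold eqs(1), auto intro: closed_Times connected_Times)
    qed
  next
    case (local x)
    then obtain d where "d > 0"
      "\<And>a b. \<lbrakk>0 \<le> a; a \<le> x; x \<le> b; b \<le> 1; b - a < d\<rbrakk> \<Longrightarrow> liftable h ({a..b} \<times> {0..1})"
      using liftable_strip[OF h, of x] by auto
    then show ?case unfolding P_def by auto
  qed
  then show ?thesis by (simp add: P_def)
qed

text \<open>The path is viewed as a square that is constant in the first coordinate, and the lift is
  restricted to the left edge.\<close>

lemma path_lift_exists:
  assumes "pathin B \<phi>" "e \<in> topspace E" "p e = \<phi> 0"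
  obtains \<psi> where "pathin E \<psi>" "\<And>t. t \<in> {0..1} \<Longrightarrow> p (\<psi> t) = \<phi> t" "\<psi> 0 = e"
proof -
  have "continuous_map (top_of_set ({0..1::real} \<times> {0..1::real})) (top_of_set {0..1}) snd"
    by (auto simp: continuous_map_in_subtopology intro!: continuous_intros)
  from continuous_map_compose[OF this assms(1)[unfolded pathin_def]]
  have l: "liftable (\<phi> \<circ> snd) ({0..1} \<times> {0..1})" by (rule liftable_square)
  have "(0, 0) \<in> {0..1::real} \<times> {0..1::real}" "p e = (\<phi> \<circ> snd) (0, 0)"
    using assms by simp_all
  from l[unfolded liftable_def, rule_format, OF this(1) assms(2) this(2)]
  obtain k :: "real \<times> real \<Rightarrow> 'a" where k: "continuous_map (top_of_set ({0..1} \<times> {0..1})) E k"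
      "\<forall>w\<in>{0..1} \<times> {0..1}. p (k w) = (\<phi> \<circ> snd) w" "k (0, 0) = e"
    by blast
  have "continuous_map (top_of_set {0..1}) (top_of_set ({0..1::real} \<times> {0..1::real})) (\<lambda>t. (0, t))"
    by (auto simp: continuous_map_in_subtopology intro!: continuous_intros)
  from continuous_map_compose[OF this k(1)] show thesis
    using k by (intro that[of "\<lambda>t. k (0, t)"]) (auto simp: pathin_def o_def)
qed

lemma path_lifts_agree:
  assumes "pathin E \<psi>" "pathin E \<psi>'" "\<And>t. t \<in> {0..1} \<Longrightarrow> p (\<psi> t) = p (\<psi>' t)" "\<psi> 0 = \<psi>' 0" "t \<in> {0..1}"
  shows "\<psi> t = \<psi>' t"
proof (rule lifts_agree[where Z = "top_of_set {0..1}" and f = \<psi> and g = \<psi>' and a = 0])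
  show "connected_space (top_of_set {0..1::real})"
    by (metis connectedin_def connectedin_iff_connected connected_Icc)
qed (use assms in \<open>auto simp: pathin_def\<close>)

end

section \<open>The covering of the unordered configuration space\<close>

lemma Hausdorff_space_disjoint_neighbourhoods:
  assumes X: "Hausdorff_space X" and I: "finite I" and y: "y \<in> I \<rightarrow> topspace X" "inj_on y I"
  obtains U where "\<And>i. i \<in> I \<Longrightarrow> openin X (U i)" "\<And>i. i \<in> I \<Longrightarrow> y i \<in> U i" "disjoint_family_on U I"
proof -
  have "\<exists>A B. i \<noteq> j \<longrightarrow> openin X A \<and> openin X B \<and> y i \<in> A \<and> y j \<in> B \<and> disjnt A B"
    if "i \<in> I" "j \<in> I" for i j
  proof (cases "i = j")
    case False
    then have "y i \<noteq> y j" "y i \<in> topspace X" "y j \<in> topspace X"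
      using y that by (auto dest: inj_onD)
    then show ?thesis
      using X unfolding Hausdorff_space_def by blast
  qed simp
  then obtain A B where AB: "\<And>i j. \<lbrakk>i \<in> I; j \<in> I; i \<noteq> j\<rbrakk> \<Longrightarrow>
      openin X (A i j) \<and> openin X (B i j) \<and> y i \<in> A i j \<and> y j \<in> B i j \<and> disjnt (A i j) (B i j)"
    by metis
  \<comment> \<open>The choices for \<open>(i, j)\<close> and \<open>(j, i)\<close> are unrelated,
    so \<open>U i\<close> is cut down by both; then \<open>U i\<close> lies in \<open>A i j\<close>
    and \<open>U j\<close> in \<open>B i j\<close>. The factor \<open>topspace X\<close> covers the
    empty intersection.\<close>
  define U where "U i = topspace X \<inter> (\<Inter>j\<in>I - {i}. A i j \<inter> B j i)" for i
  show thesis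
  proof
    fix i assume i: "i \<in> I"
    show "y i \<in> U i" using AB i y(1) by (auto simp: U_def)
    show "openin X (U i)"
    proof (cases "I - {i} = {}")
      case True
      show ?thesis unfolding U_def True by simp
    next
      case False
      then have "openin X (\<Inter>j\<in>I - {i}. A i j \<inter> B j i)"
        using AB i I by (intro openin_INT2 openin_Int) auto
      then show ?thesis by (simp add: U_def openin_Int)
    qed
  next
    show "disjoint_family_on U I"
      unfolding disjoint_family_on_def
    proof (intro ballI impI)
      fix i j assume ij: "i \<in> I" "j \<in> I" "i \<noteq> j"
      then have "U i \<subseteq> A i j" "U j \<subseteq> B i j" by (auto simp: U_def)
      then show "U i \<inter> U j = {}" using AB[OF ij] by (auto simp: disjnt_def)
    qed
  qed
qed

section \<open>Ordered configurations and the action of the symmetric group\<close>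

lemma topspace_ordered_config:
  "topspace (ordered_config n X) = {y \<in> {1..n} \<rightarrow>\<^sub>E topspace X. inj_on y {1..n}}"
  by (auto simp: ordered_config_def)

lemma continuous_map_into_ordered_config:
  "continuous_map Z (ordered_config n X) f \<longleftrightarrow>
     (\<forall>z\<in>topspace Z. f z \<in> extensional {1..n} \<and> inj_on (f z) {1..n}) \<and>
     (\<forall>i\<in>{1..n}. continuous_map Z X (\<lambda>z. f z i))"
  unfolding ordered_config_def continuous_map_in_subtopology continuous_map_componentwise
  by auto

lemma continuous_map_strand:
  assumes "continuous_map Z (ordered_config n X) f" "i \<in> {1..n}"
  shows "continuous_map Z X (\<lambda>z. f z i)"
  using assms by (simp add: continuous_map_into_ordered_config)

lemma continuous_map_permute_config:
  assumes "\<sigma> permutes {1..n}"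
  shows "continuous_map (ordered_config n X) (ordered_config n X) (\<lambda>y. y \<circ> \<sigma>)"
  unfolding continuous_map_into_ordered_config
proof (intro conjI ballI)
  fix y assume "y \<in> topspace (ordered_config n X)"
  then have y: "y \<in> extensional {1..n}" "inj_on y {1..n}"
    by (auto simp: topspace_ordered_config PiE_iff)
  show "y \<circ> \<sigma> \<in> extensional {1..n}"
    using y(1) permutes_not_in[OF assms] by (auto simp: extensional_def)
  show "inj_on (y \<circ> \<sigma>) {1..n}"
    using y(2) permutes_image[OF assms] permutes_inj_on[OF assms] by (intro comp_inj_on) auto
next
  fix i assume "i \<in> {1..n}"
  then have "\<sigma> i \<in> {1..n}" using permutes_in_image[OF assms] by blast
  from continuous_map_strand[OF continuous_map_id this]
  show "continuous_map (ordered_config n X) X (\<lambda>y. (y \<circ> \<sigma>) i)" by simp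
qed

lemma config_orbit_permute:
  assumes "\<sigma> permutes {1..n}"
  shows "config_orbit n (y \<circ> \<sigma>) = config_orbit n y"
proof (intro equalityI subsetI)
  fix z assume "z \<in> config_orbit n (y \<circ> \<sigma>)"
  then obtain \<tau> where "\<tau> permutes {1..n}" "z = y \<circ> (\<sigma> \<circ> \<tau>)"
    by (auto simp: config_orbit_def o_assoc)
  then show "z \<in> config_orbit n y"
    using permutes_compose[of \<tau> _ \<sigma>] assms by (auto simp: config_orbit_def)
next
  fix z assume "z \<in> config_orbit n y"
  then obtain \<tau> where \<tau>: "\<tau> permutes {1..n}" "z = y \<circ> \<tau>"
    by (auto simp: config_orbit_def)
  have "z = (y \<circ> \<sigma>) \<circ> (inv_into UNIV \<sigma> \<circ> \<tau>)"
    using \<tau>(2) permutes_inv_o(1)[OF assms] by (metis comp_assoc comp_id)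
  moreover have "inv_into UNIV \<sigma> \<circ> \<tau> permutes {1..n}"
    using \<tau>(1) permutes_inv[OF assms] by (rule permutes_compose)
  ultimately show "z \<in> config_orbit n (y \<circ> \<sigma>)"
    unfolding config_orbit_def by blast
qed

lemma config_orbit_eq_iff:
  "config_orbit n y = config_orbit n z \<longleftrightarrow> (\<exists>\<sigma>. \<sigma> permutes {1..n} \<and> z = y \<circ> \<sigma>)"
proof
  assume *: "config_orbit n y = config_orbit n z"
  have "z \<in> config_orbit n z"
    unfolding config_orbit_def by (rule CollectI) (intro exI[of _ id], simp add: permutes_id)
  then show "\<exists>\<sigma>. \<sigma> permutes {1..n} \<and> z = y \<circ> \<sigma>"
    unfolding *[symmetric] by (auto simp: config_orbit_def)
qed (auto simp: config_orbit_permute)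

lemma topspace_unordered_config:
  "topspace (unordered_config n X) = config_orbit n ` topspace (ordered_config n X)"
  by (simp add: unordered_config_def)

lemma continuous_map_config_orbit:
  "continuous_map (ordered_config n X) (unordered_config n X) (config_orbit n)"
  unfolding continuous_map_def topspace_unordered_config
  by (auto simp: unordered_config_def openin_quotient_topology)

text \<open>The saturation of \<open>V\<close> is a union of preimages of \<open>V\<close> under the
  continuous permutation maps, so the quotient map is open.\<close>

lemma openin_config_orbit_image:
  assumes "openin (ordered_config n X) V"
  shows "openin (unordered_config n X) (config_orbit n ` V)"
  unfolding unordered_config_def openin_quotient_topology
proof
  let ?F = "ordered_config n X"
  have V: "V \<subseteq> topspace ?F" using assms openin_subset by blast
  then show "config_orbit n ` V \<subseteq> config_orbit n ` topspace ?F" by blast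
  have "{y \<in> topspace ?F. config_orbit n y \<in> config_orbit n ` V} =
      (\<Union>\<sigma>\<in>{\<sigma>. \<sigma> permutes {1..n}}. {y \<in> topspace ?F. y \<circ> \<sigma> \<in> V})"
    by (force simp: image_iff config_orbit_eq_iff)
  moreover have "openin ?F {y \<in> topspace ?F. y \<circ> \<sigma> \<in> V}" if "\<sigma> permutes {1..n}" for \<sigma>
    using openin_continuous_map_preimage[OF continuous_map_permute_config[OF that] assms] .
  ultimately show "openin ?F {y \<in> topspace ?F. config_orbit n y \<in> config_orbit n ` V}"
    by (auto intro!: openin_Union)
qed

text \<open>Disjoint neighbourhoods of the n points pin down the labels: if \<open>z\<close> and
  \<open>z \<circ> \<sigma>\<close> both lie in their product, then \<open>z (\<sigma> i)\<close>
  lies in \<open>U (\<sigma> i)\<close> and in \<open>U i\<close>, so \<open>\<sigma>\<close> is the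
  identity.\<close>

lemma config_orbit_locally_inj:
  assumes X: "Hausdorff_space X" and y: "y \<in> topspace (ordered_config n X)"
  obtains V where "openin (ordered_config n X) V" "y \<in> V" "inj_on (config_orbit n) V"
proof -
  have y': "y \<in> {1..n} \<rightarrow>\<^sub>E topspace X" "inj_on y {1..n}"
    using y by (auto simp: topspace_ordered_config)
  obtain U where U: "\<And>i. i \<in> {1..n} \<Longrightarrow> openin X (U i)" "\<And>i. i \<in> {1..n} \<Longrightarrow> y i \<in> U i"
      "disjoint_family_on U {1..n}"
    using Hausdorff_space_disjoint_neighbourhoods[OF X, of "{1..n}" y] y' by auto
  let ?V = "(\<Pi>\<^sub>E i\<in>{1..n}. U i) \<inter> {y. inj_on y {1..n}}"
  show thesis
  proof
    have "openin (product_topology (\<lambda>i. X) {1..n}) (\<Pi>\<^sub>E i\<in>{1..n}. U i)"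
      using U(1) by (simp add: openin_PiE)
    then show "openin (ordered_config n X) ?V"
      unfolding ordered_config_def by (auto simp: openin_subtopology)
    show "y \<in> ?V" using y' U(2) by (auto simp: PiE_iff)
    show "inj_on (config_orbit n) ?V"
    proof (rule inj_onI)
      fix z w assume z: "z \<in> ?V" and w: "w \<in> ?V" and "config_orbit n z = config_orbit n w"
      then obtain \<sigma> where \<sigma>: "\<sigma> permutes {1..n}" "w = z \<circ> \<sigma>"
        by (auto simp: config_orbit_eq_iff)
      have "\<sigma> i = i" for i
      proof (cases "i \<in> {1..n}")
        case True
        then have \<sigma>i: "\<sigma> i \<in> {1..n}" using permutes_in_image[OF \<sigma>(1)] by blast
        have "z (\<sigma> i) \<in> U (\<sigma> i)" using z \<sigma>i by (auto simp: PiE_iff)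
        moreover have "z (\<sigma> i) \<in> U i" using w True \<sigma>(2) by (auto simp: PiE_iff)
        ultimately show ?thesis
          using U(3) True \<sigma>i unfolding disjoint_family_on_def by blast
      qed (use permutes_not_in[OF \<sigma>(1)] in blast)
      then show "z = w" using \<sigma>(2) by (simp add: fun_eq_iff)
    qed
  qed
qed

text \<open>The inverse of an injective open map is continuous.\<close>

lemma config_orbit_section:
  assumes V: "openin (ordered_config n X) V" "inj_on (config_orbit n) V"
  obtains s where "continuous_map (subtopology (unordered_config n X) (config_orbit n ` V)) (ordered_config n X) s"
    "\<And>w. w \<in> config_orbit n ` V \<Longrightarrow> s w \<in> V \<and> config_orbit n (s w) = w"
proof
  let ?q = "config_orbit n"
  let ?s = "inv_into V ?q"
  show s: "?s w \<in> V \<and> ?q (?s w) = w" if "w \<in> ?q ` V" for w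
    using that by (auto simp: inv_into_into f_inv_into_f)
  have VF: "V \<subseteq> topspace (ordered_config n X)" using V(1) openin_subset by blast
  have top: "topspace (subtopology (unordered_config n X) (?q ` V)) = ?q ` V"
    using VF by (auto simp: topspace_unordered_config)
  show "continuous_map (subtopology (unordered_config n X) (?q ` V)) (ordered_config n X) ?s"
    unfolding continuous_map_def top
  proof (intro conjI allI impI)
    show "?s \<in> ?q ` V \<rightarrow> topspace (ordered_config n X)"
      using s VF by blast
    fix O' assume O': "openin (ordered_config n X) O'"
    have "{w \<in> ?q ` V. ?s w \<in> O'} = ?q ` (V \<inter> O')"
      using V(2) by (auto simp: inv_into_f_f)
    moreover have "openin (unordered_config n X) (?q ` (V \<inter> O'))"
      using V(1) O' by (intro openin_config_orbit_image openin_Int)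
    then have "openin (subtopology (unordered_config n X) (?q ` V)) (?q ` (V \<inter> O'))"
      by (rule subset_openin_subtopology) blast
    ultimately show "openin (subtopology (unordered_config n X) (?q ` V)) {w \<in> ?q ` V. ?s w \<in> O'}"
      by simp
  qed
qed

text \<open>One section over the image of \<open>V\<close> suffices: a point over that image is a
  reordering of a point of \<open>V\<close>, and composing the section with this permutation moves
  it to the required sheet.\<close>

lemma sectioned_map_config_orbit:
  assumes X: "Hausdorff_space X"
  shows "sectioned_map (ordered_config n X) (unordered_config n X) (config_orbit n)"
proof
  let ?F = "ordered_config n X" and ?q = "config_orbit n"
  show "Hausdorff_space ?F"
    unfolding ordered_config_def using X
    by (simp add: Hausdorff_space_subtopology Hausdorff_space_product_topology)
  show "\<exists>V. openin ?F V \<and> e \<in> V \<and> inj_on ?q V" if "e \<in> topspace ?F" for e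
    using config_orbit_locally_inj[OF X that] by blast
  fix b assume "b \<in> topspace (unordered_config n X)"
  then obtain y where y: "y \<in> topspace ?F" "b = ?q y"
    by (auto simp: topspace_unordered_config)
  obtain V where V: "openin ?F V" "y \<in> V" "inj_on ?q V"
    using config_orbit_locally_inj[OF X y(1)] by blast
  obtain s where s: "continuous_map (subtopology (unordered_config n X) (?q ` V)) ?F s"
      and sq: "\<And>w. w \<in> ?q ` V \<Longrightarrow> s w \<in> V \<and> ?q (s w) = w"
    using config_orbit_section[OF V(1,3)] by blast
  have "\<exists>s. continuous_map (subtopology (unordered_config n X) (?q ` V)) ?F s \<and> s (?q e) = e \<and>
      (\<forall>w\<in>?q ` V. ?q (s w) = w)" if e: "e \<in> topspace ?F" "?q e \<in> ?q ` V" for e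
  proof -
    have "?q (s (?q e)) = ?q e" using sq e by blast
    then obtain \<sigma> where \<sigma>: "\<sigma> permutes {1..n}" "e = s (?q e) \<circ> \<sigma>"
      by (auto simp: config_orbit_eq_iff)
    show ?thesis
    proof (intro exI conjI ballI)
      show "continuous_map (subtopology (unordered_config n X) (?q ` V)) ?F ((\<lambda>y. y \<circ> \<sigma>) \<circ> s)"
        by (rule continuous_map_compose[OF s continuous_map_permute_config[OF \<sigma>(1)]])
      show "((\<lambda>y. y \<circ> \<sigma>) \<circ> s) (?q e) = e" using \<sigma>(2) by simp
      show "?q (((\<lambda>y. y \<circ> \<sigma>) \<circ> s) w) = w" if "w \<in> ?q ` V" for w
        using sq[OF that] config_orbit_permute[OF \<sigma>(1), of "s w"] by simp
    qed
  qed
  then show "\<exists>W. openin (unordered_config n X) W \<and> b \<in> W \<and>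
      (\<forall>e\<in>topspace ?F. ?q e \<in> W \<longrightarrow> (\<exists>s. continuous_map (subtopology (unordered_config n X) W) ?F s \<and>
        s (?q e) = e \<and> (\<forall>w\<in>W. ?q (s w) = w)))"
    using openin_config_orbit_image[OF V(1)] y(2) V(2) by blast
qed

section \<open>The total winding number\<close>

text \<open>By uniqueness of path lifts, any lift with the right start is the one described by
  \<open>THE\<close>, up to the normalisation outside the unit interval.\<close>

lemma config_lift_eq:
  assumes X: "Hausdorff_space X"
    and \<psi>: "pathin (ordered_config n X) \<psi>" "\<psi> 0 = x" "\<And>t. t \<in> {0..1} \<Longrightarrow> config_orbit n (\<psi> t) = \<phi> t"
  shows "config_lift n X x \<phi> = restrict \<psi> {0..1}"
  unfolding config_lift_def
proof (rule the_equality)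
  interpret sectioned_map "ordered_config n X" "unordered_config n X" "config_orbit n"
    by (rule sectioned_map_config_orbit[OF X])
  let ?r = "restrict \<psi> {0..1}"
  have "pathin (ordered_config n X) ?r"
    using \<psi>(1) by (simp add: pathin_def)
  then show "?r \<in> extensional {0..1} \<and> pathin (ordered_config n X) ?r \<and>
      (\<forall>t\<in>{0..1}. config_orbit n (?r t) = \<phi> t) \<and> ?r 0 = x"
    using \<psi> by simp
  fix \<psi>' assume \<psi>': "\<psi>' \<in> extensional {0..1} \<and> pathin (ordered_config n X) \<psi>' \<and>
      (\<forall>t\<in>{0..1}. config_orbit n (\<psi>' t) = \<phi> t) \<and> \<psi>' 0 = x"
  show "\<psi>' = ?r"
  proof (rule extensionalityI[of _ "{0..1}"])
    fix t :: real assume t: "t \<in> {0..1}"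
    have "\<psi>' t = \<psi> t"
      by (rule path_lifts_agree[of \<psi>' \<psi>]) (use \<psi>' \<psi> t in auto)
    then show "\<psi>' t = ?r t" using t by simp
  qed (use \<psi>' in auto)
qed

lemma loop_winding_eq:
  assumes "Hausdorff_space X"
    and "pathin (ordered_config n X) \<psi>" "\<psi> 0 = x" "\<And>t. t \<in> {0..1} \<Longrightarrow> config_orbit n (\<psi> t) = \<phi> t"
  shows "loop_winding n X x \<phi> = homologous_rel_set 1 X {} (\<Sum>i\<in>{1..n}. path_chain (\<lambda>t. \<psi> t i))"
proof -
  have "config_lift n X x \<phi> = restrict \<psi> {0..1}"
    by (rule config_lift_eq[OF assms(1-3)]) (rule assms(4))
  then have "path_simplex (\<lambda>t. config_lift n X x \<phi> t i) = path_simplex (\<lambda>t. \<psi> t i)" for i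
    by (intro path_simplex_cong) simp
  then show ?thesis by (simp add: loop_winding_def)
qed

lemma loop_lift:
  assumes X: "Hausdorff_space X" and x: "x \<in> topspace (ordered_config n X)"
    and \<phi>: "loop_at (unordered_config n X) (config_orbit n x) \<phi>"
  obtains \<psi> where "pathin (ordered_config n X) \<psi>" "\<psi> 0 = x" "\<And>t. t \<in> {0..1} \<Longrightarrow> config_orbit n (\<psi> t) = \<phi> t"
proof -
  interpret sectioned_map "ordered_config n X" "unordered_config n X" "config_orbit n"
    by (rule sectioned_map_config_orbit[OF X])
  have "pathin (unordered_config n X) \<phi>" "config_orbit n x = \<phi> 0"
    using \<phi> by (simp_all add: loop_at_def)
  from path_lift_exists[OF this(1) x this(2)] show thesis
    using that by metis
qed

text \<open>The endpoints of the strands are a permutation of their starting points, so the boundary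
  of the sum vanishes after reindexing.\<close>

lemma loop_winding_in_homology:
  assumes X: "Hausdorff_space X" and x: "x \<in> topspace (ordered_config n X)"
    and \<phi>: "loop_at (unordered_config n X) (config_orbit n x) \<phi>"
  shows "loop_winding n X x \<phi> \<in> carrier (homology_group 1 X)"
proof -
  obtain \<psi> where \<psi>: "pathin (ordered_config n X) \<psi>" "\<psi> 0 = x" "\<And>t. t \<in> {0..1} \<Longrightarrow> config_orbit n (\<psi> t) = \<phi> t"
    using loop_lift[OF assms] by blast
  let ?c = "\<Sum>i\<in>{1..n}. path_chain (\<lambda>t. \<psi> t i)"
  have strand: "pathin X (\<lambda>t. \<psi> t i)" if "i \<in> {1..n}" for i
    using \<psi>(1) that unfolding pathin_def by (rule continuous_map_strand)
  have "config_orbit n x = config_orbit n (\<psi> 1)"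
    using \<psi>(3)[of 1] \<phi> by (simp add: loop_at_def)
  then obtain \<sigma> where \<sigma>: "\<sigma> permutes {1..n}" "\<psi> 1 = x \<circ> \<sigma>"
    by (auto simp: config_orbit_eq_iff)
  have "chain_boundary 1 ?c = (\<Sum>i\<in>{1..n}. frag_of (vertex_simplex (x (\<sigma> i))) - frag_of (vertex_simplex (x i)))"
    unfolding chain_boundary_sum o_def chain_boundary_path_chain by (simp add: \<sigma>(2) \<psi>(2))
  also have "\<dots> = (\<Sum>i\<in>{1..n}. frag_of (vertex_simplex (x (\<sigma> i)))) - (\<Sum>i\<in>{1..n}. frag_of (vertex_simplex (x i)))"
    by (rule sum_subtractf)
  also have "\<dots> = 0"
    using sum.permute[OF \<sigma>(1), of "\<lambda>i. frag_of (vertex_simplex (x i))"] by (simp add: o_def)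
  finally have "singular_relcycle 1 X {} ?c"
    unfolding singular_cycle
    using strand by (intro conjI singular_chain_sum) (simp_all only: singular_chain_of singular_simplex_path_simplex)
  then show ?thesis
    using carrier_relative_homology_group[of 1 X "{}"] loop_winding_eq[OF X \<psi>] by auto
qed

lemma loop_winding_homotopic:
  assumes X: "Hausdorff_space X" and x: "x \<in> topspace (ordered_config n X)"
    and hom: "loop_homotopic (unordered_config n X) (config_orbit n x) \<phi> \<phi>'"
  shows "loop_winding n X x \<phi> = loop_winding n X x \<phi>'"
proof -
  let ?F = "ordered_config n X" and ?C = "unordered_config n X" and ?q = "config_orbit n"
  interpret sectioned_map ?F ?C ?q by (rule sectioned_map_config_orbit[OF X])
  \<comment> \<open>The first coordinate is the homotopy parameter, the second is time along the
    braid.\<close>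
  obtain h where h: "continuous_map (top_of_set ({0..1::real} \<times> {0..1::real})) ?C h"
      and h0: "\<And>t. h (0, t) = \<phi> t" and h1: "\<And>t. h (1, t) = \<phi>' t"
      and ends: "\<And>s. s \<in> {0..1} \<Longrightarrow> h (s, 0) = ?q x \<and> h (s, 1) = ?q x"
    using hom unfolding loop_homotopic_def homotopic_with_def by auto
  have "(0, 0) \<in> {0..1::real} \<times> {0..1::real}" "?q x = h (0, 0)"
    using ends[of 0] by auto
  from liftable_square[OF h, unfolded liftable_def, rule_format, OF this(1) x this(2)]
  obtain k where k: "continuous_map (top_of_set ({0..1::real} \<times> {0..1::real})) ?F k"
      and qk: "\<And>w. w \<in> {0..1} \<times> {0..1} \<Longrightarrow> ?q (k w) = h w" and k00: "k (0, 0) = x"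
    by blast
  have edge: "pathin ?F (\<lambda>t. k (f t))" if "continuous_on {0..1} f" "f \<in> {0..1} \<rightarrow> {0..1} \<times> {0..1}" for f
  proof -
    have "continuous_map (top_of_set {0..1}) (top_of_set ({0..1} \<times> {0..1})) f"
      using that by (auto simp: continuous_map_in_subtopology)
    from continuous_map_compose[OF this k] show ?thesis by (simp add: pathin_def o_def)
  qed
  have sides: "pathin ?F (\<lambda>s. k (s, 0))" "pathin ?F (\<lambda>s. k (s, 1))" "pathin ?F (\<lambda>t. k (0, t))" "pathin ?F (\<lambda>t. k (1, t))"
    by (rule edge; auto intro!: continuous_intros)+
  have in_F: "k w \<in> topspace ?F" if "w \<in> {0..1} \<times> {0..1}" for w
    using k that unfolding continuous_map_def Pi_iff by auto
  \<comment> \<open>The side lies over a single orbit, so it is a lift of a constant path and is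
    itself constant.\<close>
  have bottom: "k (s, 0) = x" if "s \<in> {0..1}" for s
  proof (rule path_lifts_agree[where \<psi> = "\<lambda>s. k (s, 0)" and \<psi>' = "\<lambda>s. x"])
    show "?q (k (t, 0)) = ?q x" if "t \<in> {0..1}" for t
      using that qk[of "(t, 0)"] ends[of t] by simp
  qed (use sides x k00 that in simp_all)
  \<comment> \<open>The end \<open>k (0, 1)\<close> may be any reordering of \<open>x\<close>; what
    matters is that it is the same for all \<open>s\<close>.\<close>
  have top: "k (s, 1) = k (0, 1)" if "s \<in> {0..1}" for s
  proof (rule path_lifts_agree[where \<psi> = "\<lambda>s. k (s, 1)" and \<psi>' = "\<lambda>s. k (0, 1)"])
    show "?q (k (t, 1)) = ?q (k (0, 1))" if "t \<in> {0..1}" for t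
      using that qk[of "(t, 1)"] qk[of "(0, 1)"] ends[of t] ends[of 0] by simp
  qed (use sides in_F that in simp_all)
  have "homologous_rel 1 X {} (path_chain (\<lambda>t. k (1, t) i)) (path_chain (\<lambda>t. k (0, t) i))"
    if i: "i \<in> {1..n}" for i
  proof -
    have const: "homologous_rel 1 X {} (path_chain (\<lambda>t. k (t, u) i)) 0" if u: "u = 0 \<or> u = 1" for u
    proof -
      have k_u: "k (t, u) = k (0, u)" if "t \<in> {0..1}" for t
        using u bottom[OF that] top[OF that] k00 by auto
      have "path_simplex (\<lambda>t. k (t, u) i) = path_simplex (\<lambda>t. k (0, u) i)"
        by (rule path_simplex_cong) (rule fun_cong[OF k_u])
      moreover have "(0, u) \<in> {0..1::real} \<times> {0..1::real}" using u by auto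
      then have "k (0, u) \<in> {1..n} \<rightarrow>\<^sub>E topspace X"
        using in_F unfolding topspace_ordered_config by blast
      then have "k (0, u) i \<in> topspace X"
        using i by (rule PiE_mem)
      ultimately show ?thesis using homologous_const_path by metis
    qed
    have "homologous_rel 1 X {}
        (path_chain (\<lambda>t. k (t, 0) i) + path_chain (\<lambda>t. k (1, t) i))
        (path_chain (\<lambda>t. k (0, t) i) + path_chain (\<lambda>t. k (t, 1) i))"
      by (rule homologous_square[OF continuous_map_strand[OF k i]])
    from homologous_rel_diff[OF homologous_rel_diff[OF this const[of 0]] homologous_rel_symD[OF const[of 1]]]
    show ?thesis by simp
  qed
  then have "homologous_rel 1 X {} (\<Sum>i\<in>{1..n}. path_chain (\<lambda>t. k (1, t) i)) (\<Sum>i\<in>{1..n}. path_chain (\<lambda>t. k (0, t) i))"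
    by (intro homologous_rel_sum) auto
  moreover have "loop_winding n X x \<phi> = homologous_rel_set 1 X {} (\<Sum>i\<in>{1..n}. path_chain (\<lambda>t. k (0, t) i))"
    by (rule loop_winding_eq[OF X sides(3)]) (use k00 qk h0 in auto)
  moreover have "loop_winding n X x \<phi>' = homologous_rel_set 1 X {} (\<Sum>i\<in>{1..n}. path_chain (\<lambda>t. k (1, t) i))"
    by (rule loop_winding_eq[OF X sides(4)]) (use bottom qk h1 in auto)
  ultimately show ?thesis
    using homologous_rel_set_eq homologous_rel_symD by metis
qed

text \<open>Homotopy invariance leaves one value on the class, and the class contains
  \<open>\<phi>\<close> by reflexivity; this makes \<open>the_elem\<close> meaningful.\<close>

lemma total_winding_loop_class:
  assumes X: "Hausdorff_space X" and x: "x \<in> topspace (ordered_config n X)"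
    and \<phi>: "loop_at (unordered_config n X) (config_orbit n x) \<phi>"
  shows "total_winding n X x (loop_class (unordered_config n X) (config_orbit n x) \<phi>) = loop_winding n X x \<phi>"
proof -
  let ?c = "loop_class (unordered_config n X) (config_orbit n x) \<phi>"
  have "\<phi> \<in> ?c"
    using \<phi> by (auto simp: loop_class_def loop_homotopic_def loop_at_def pathin_def)
  moreover have "loop_winding n X x \<phi>' = loop_winding n X x \<phi>" if "\<phi>' \<in> ?c" for \<phi>'
    using loop_winding_homotopic[OF X x, of \<phi> \<phi>'] that by (simp add: loop_class_def)
  ultimately have "loop_winding n X x ` ?c = {loop_winding n X x \<phi>}" by blast
  then show ?thesis by (simp add: total_winding_def)
qed

section \<open>Realising a homology class by a braid\<close>

lemma loop_winding_surj:
  assumes X: "locally_planar X" "connected_space X" "Hausdorff_space X"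
    and n: "n \<ge> 1" and x: "x \<in> topspace (ordered_config n X)" and c: "singular_relcycle 1 X {} c"
  obtains \<phi> where "loop_at (unordered_config n X) (config_orbit n x) \<phi>"
    and "loop_winding n X x \<phi> = homologous_rel_set 1 X {} c"
proof -
  have xP: "x \<in> {1..n} \<rightarrow>\<^sub>E topspace X" and inj: "inj_on x {1..n}"
    using x by (auto simp: topspace_ordered_config)
  let ?Q = "x ` {2..n}"
  have "x 1 \<notin> ?Q" using inj n by (auto dest: inj_onD)
  then have b: "x 1 \<in> topspace X - ?Q" using xP n by auto
  obtain p where p: "loop_at (subtopology X (topspace X - ?Q)) (x 1) p"
      and cp: "homologous_rel 1 X {} c (path_chain p)"
    using cycle_homologous_loop_avoiding_finite[OF X(1,2) Hausdorff_imp_t1_space[OF X(3)] _ c b] by auto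
  have pX: "pathin X p" and pQ: "\<And>t. t \<in> {0..1} \<Longrightarrow> p t \<notin> ?Q" and pends: "p 0 = x 1" "p 1 = x 1"
    using p by (auto simp: loop_at_def pathin_subtopology)
  \<comment> \<open>The other points stand still, so distinctness at time \<open>t\<close> reduces
    to \<open>p t\<close> avoiding \<open>?Q\<close>.\<close>
  define \<psi> where "\<psi> t = x(1 := p t)" for t
  have \<psi>: "pathin (ordered_config n X) \<psi>"
    unfolding pathin_def continuous_map_into_ordered_config
  proof (intro conjI ballI)
    fix t :: real assume "t \<in> topspace (top_of_set {0..1})"
    then have t: "t \<in> {0..1}" by simp
    show "\<psi> t \<in> extensional {1..n}" using xP n by (auto simp: \<psi>_def PiE_iff extensional_def)
    have "inj_on (\<psi> t) {2..n}"
      unfolding \<psi>_def using inj pQ[OF t] by (intro inj_on_fun_updI) (auto intro: inj_on_subset)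
    moreover have "\<psi> t ` {2..n} = ?Q" by (auto simp: \<psi>_def)
    moreover have "{1..n} = insert 1 {2..n}" using n by auto
    ultimately show "inj_on (\<psi> t) {1..n}"
      using pQ[OF t] by (simp add: inj_on_insert) (simp add: \<psi>_def)
  next
    fix i assume i: "i \<in> {1..n}"
    show "continuous_map (top_of_set {0..1}) X (\<lambda>t. \<psi> t i)"
      using pX xP i by (cases "i = 1") (auto simp: \<psi>_def pathin_def PiE_iff)
  qed
  let ?\<phi> = "\<lambda>t. config_orbit n (\<psi> t)"
  have "pathin (unordered_config n X) ?\<phi>"
    using continuous_map_compose[OF \<psi>[unfolded pathin_def] continuous_map_config_orbit]
    by (simp add: pathin_def o_def)
  moreover have ends: "\<psi> 0 = x" "\<psi> 1 = x" by (simp_all add: \<psi>_def pends)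
  ultimately have "loop_at (unordered_config n X) (config_orbit n x) ?\<phi>"
    by (simp add: loop_at_def)
  moreover have "loop_winding n X x ?\<phi> = homologous_rel_set 1 X {} c"
  proof -
    have "loop_winding n X x ?\<phi> = homologous_rel_set 1 X {} (\<Sum>i\<in>{1..n}. path_chain (\<lambda>t. \<psi> t i))"
      by (rule loop_winding_eq[OF X(3) \<psi> ends(1)]) simp
    \<comment> \<open>\<open>c\<close> is written as a sum over the same index set so that strands
      can be compared one by one.\<close>
    moreover have "homologous_rel 1 X {} (\<Sum>i\<in>{1..n}. path_chain (\<lambda>t. \<psi> t i)) (\<Sum>i\<in>{1..n}. if i = 1 then c else 0)"
    proof (rule homologous_rel_sum)
      fix i assume i: "i \<in> {1..n}"
      show "homologous_rel 1 X {} (path_chain (\<lambda>t. \<psi> t i)) (if i = 1 then c else 0)"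
      proof (cases "i = 1")
        case True
        then show ?thesis using homologous_rel_symD[OF cp] by (simp add: \<psi>_def)
      next
        case False
        then show ?thesis using homologous_const_path[OF PiE_mem[OF xP i]] by (simp add: \<psi>_def)
      qed
    qed auto
    moreover have "(\<Sum>i\<in>{1..n}. if i = 1 then c else 0) = c" using n by simp
    ultimately show ?thesis by (simp add: homologous_rel_set_eq)
  qed
  ultimately show thesis using that by blast
qed

theorem mainTheorem3:
  fixes X :: "'a topology" and g n :: nat and x :: "nat \<Rightarrow> 'a"
  assumes "closed_orientable_surface g X"
    and "n \<ge> 1"
    and "x \<in> topspace (ordered_config n X)"
  shows "total_winding n X x ` carrier (braid_group n X x) = carrier (homology_group 1 X)"
proof -
  let ?C = "unordered_config n X" and ?b = "config_orbit n x"
  have X: "locally_planar X" "connected_space X" "Hausdorff_space X"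
    using assms(1) by (auto simp: closed_orientable_surface_def closed_surface_def locally_planar_def)
  have "carrier (braid_group n X x) = loop_class ?C ?b ` Collect (loop_at ?C ?b)"
    by (simp add: braid_group_def fundamental_group_def)
  then have "total_winding n X x ` carrier (braid_group n X x) = loop_winding n X x ` Collect (loop_at ?C ?b)"
    using total_winding_loop_class[OF X(3) assms(3)] by (simp add: image_image)
  also have "\<dots> = carrier (homology_group 1 X)"
  proof
    show "loop_winding n X x ` Collect (loop_at ?C ?b) \<subseteq> carrier (homology_group 1 X)"
      using loop_winding_in_homology[OF X(3) assms(3)] by blast
    show "carrier (homology_group 1 X) \<subseteq> loop_winding n X x ` Collect (loop_at ?C ?b)"
    proof
      fix a assume "a \<in> carrier (homology_group 1 X)"
      then obtain c where c: "singular_relcycle 1 X {} c" "a = homologous_rel_set 1 X {} c"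
        using carrier_relative_homology_group[of 1 X "{}"] by auto
      obtain \<phi> where "loop_at ?C ?b \<phi>" "loop_winding n X x \<phi> = homologous_rel_set 1 X {} c"
        using loop_winding_surj[OF X assms(2,3) c(1)] by blast
      then show "a \<in> loop_winding n X x ` Collect (loop_at ?C ?b)"
        using c(2) by (metis image_eqI mem_Collect_eq)
    qed
  qed
  finally show ?thesis .
qed

end
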